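(* Let $G$ be a graph on $n$ vertices ($n$ possibly $0$) that is point-determining and such that for every $\pi \in \mathrm{Aut}(G)$ other than the identity, some cycle in the cycle decomposition of $\pi$ contains at least two vertices that are adjacent in $G$. Let $G'$ be obtained from $G$ by adding two new vertices $x$ and $y$ (not adjacent to each other) and making each of $x$ and $y$ adjacent to every vertex of $G$. Let $\mathcal{G}'$ be the unlabeled graph containing $G'$. Then there exists $N \in \mathbb{N}$ such that $P_{\ell}(\mathcal{G}',k) = P(\mathcal{G}',k)$ for all integers $k \geq N$.
   Context: All graphs are finite and simple. A graph is point-determining if no two distinct vertices have the same neighborhood. Cycle decompositions include $1$-cycles. An unlabeled graph $\mathcal{G}$ of order $n$ is an isomorphism class of graphs, each with vertex set $\{v_1,\ldots,v_n\}$. A $k$-assignment $L$ for a graph $H$ assigns to each vertex $v$ a set $L(v)$ of $k$ colors; a proper $L$-coloring is a proper coloring $f$ with $f(v)\in L(v)$ for all $v$. For $H \in \mathcal{G}$ and a $k$-assignment $L$, two proper $L$-colorings $f,g$ of $H$ are equivalent if $f\pi = g$ for some $\pi \in \mathrm{Aut}(H)$; $u_\ell(H,L)$ is the number of equivalence classes. $P_\ell(\mathcal{G},k)$ is the minimum of $u_\ell(H,L)$ over all $k$-assignments $L$ of $H$ (for an arbitrarily chosen $H\in\mathcal{G}$). $P(\mathcal{G},k)$ (Hanlon's unlabeled chromatic polynomial) is the number of orbits of $S_n$ acting on pairs $(H,f)$, $H\in\mathcal{G}$, $f$ a proper coloring of $H$ from $[k]$, via $\pi\cdot(H,f)=(\pi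 H, f\pi^{-1})$ with $E(\pi H)=\{\pi(v_i)\pi(v_j): v_iv_j\in E(H)\}$; equivalently it is $u_\ell(H,L)$ for $L(v)=[k]$ for all $v$. *)

theory Defs
  imports "HOL-Combinatorics.Combinatorics" "HOL-Library.FuncSet"
begin

record 'a sgraph =
  verts :: "'a set"
  edges :: "'a set set"

definition simple_graph :: "'a sgraph \<Rightarrow> bool" where
  "simple_graph G \<longleftrightarrow> finite (verts G) \<and>
     edges G \<subseteq> {{u, v} | u v. u \<in> verts G \<and> v \<in> verts G \<and> u \<noteq> v}"

abbreviation adjacent :: "'a sgraph \<Rightarrow> 'a \<Rightarrow> 'a \<Rightarrow> bool" where
  "adjacent G u v \<equiv> {u, v} \<in> edges G"

definition neighborhood :: "'a sgraph \<Rightarrow> 'a \<Rightarrow> 'a set" where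
  "neighborhood G v = {u \<in> verts G. adjacent G v u}"

definition point_determining :: "'a sgraph \<Rightarrow> bool" where
  "point_determining G \<longleftrightarrow>
     (\<forall>u \<in> verts G. \<forall>v \<in> verts G. u \<noteq> v \<longrightarrow> neighborhood G u \<noteq> neighborhood G v)"

definition graph_isomorphism :: "('a \<Rightarrow> 'b) \<Rightarrow> 'a sgraph \<Rightarrow> 'b sgraph \<Rightarrow> bool" where
  "graph_isomorphism \<phi> G H \<longleftrightarrow> bij_betw \<phi> (verts G) (verts H) \<and>
     (\<forall>u \<in> verts G. \<forall>v \<in> verts G. adjacent G u v \<longleftrightarrow> adjacent H (\<phi> u) (\<phi> v))"

definition isomorphic :: "'a sgraph \<Rightarrow> 'b sgraph \<Rightarrow> bool" where
  "isomorphic G H \<longleftrightarrow> (\<exists>\<phi>. graph_isomorphism \<phi> G H)"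

text \<open>Automorphisms fix every element of the type outside the vertex set, so that each
  automorphism of the graph is represented by exactly one function.\<close>

definition Aut :: "'a sgraph \<Rightarrow> ('a \<Rightarrow> 'a) set" where
  "Aut G = {\<pi>. \<pi> permutes verts G \<and> graph_isomorphism \<pi> G G}"

text \<open>The vertex sets of the cycles in the cycle decomposition of a permutation of a
  finite set \<open>V\<close>. A fixed point gives a 1-cycle, since \<open>orbit \<pi> v = {v}\<close> if \<open>\<pi> v = v\<close>.\<close>

definition cycles_of :: "('a \<Rightarrow> 'a) \<Rightarrow> 'a set \<Rightarrow> 'a set set" where
  "cycles_of \<pi> V = orbit \<pi> ` V"

definition add_two_vertices :: "'a sgraph \<Rightarrow> 'a \<Rightarrow> 'a \<Rightarrow> 'a sgraph" where
  "add_two_vertices G x y =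
     \<lparr>verts = verts G \<union> {x, y},
      edges = edges G \<union> {{x, v} | v. v \<in> verts G} \<union> {{y, v} | v. v \<in> verts G}\<rparr>"

text \<open>The unlabeled graph containing \<open>G\<close>: all graphs isomorphic to \<open>G\<close> whose vertex set is
  \<open>{v\<^sub>1, \<dots>, v\<^sub>n}\<close>, with \<open>v\<^sub>i\<close> represented by the number \<open>i\<close>. The graph \<open>G\<close>
  itself may live on vertices of any type.\<close>

definition unlabeled :: "'a sgraph \<Rightarrow> nat sgraph set" where
  "unlabeled G = {H. simple_graph H \<and> verts H = {1..card (verts G)} \<and> isomorphic G H}"

text \<open>Colors are natural numbers. Colorings are extensional (\<open>undefined\<close> outside the vertex
  set), so that two colorings are equal iff they agree on every vertex.\<close>

definition k_assignment :: "'a sgraph \<Rightarrow> nat \<Rightarrow> ('a \<Rightarrow> nat set) \<Rightarrow> bool" where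
  "k_assignment H k L \<longleftrightarrow> (\<forall>v \<in> verts H. finite (L v) \<and> card (L v) = k)"

definition list_colorings :: "'a sgraph \<Rightarrow> ('a \<Rightarrow> nat set) \<Rightarrow> ('a \<Rightarrow> nat) set" where
  "list_colorings H L =
     {f \<in> (\<Pi>\<^sub>E v \<in> verts H. L v). \<forall>u \<in> verts H. \<forall>v \<in> verts H. adjacent H u v \<longrightarrow> f u \<noteq> f v}"

definition coloring_equiv :: "'a sgraph \<Rightarrow> ('a \<Rightarrow> nat set) \<Rightarrow> (('a \<Rightarrow> nat) \<times> ('a \<Rightarrow> nat)) set" where
  "coloring_equiv H L =
     {(f, g). f \<in> list_colorings H L \<and> g \<in> list_colorings H L \<and> (\<exists>\<pi> \<in> Aut H. f \<circ> \<pi> = g)}"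

definition u_list :: "'a sgraph \<Rightarrow> ('a \<Rightarrow> nat set) \<Rightarrow> nat" where
  "u_list H L = card (list_colorings H L // coloring_equiv H L)"

definition min_u_list :: "'a sgraph \<Rightarrow> nat \<Rightarrow> nat" where
  "min_u_list H k = (LEAST m. \<exists>L. k_assignment H k L \<and> m = u_list H L)"

text \<open>The choice of \<open>H\<close> is immaterial, and possible for \<open>\<G> = unlabeled G\<close>; see \<open>P_list_eq\<close> and
  \<open>unlabeled_nonempty\<close> below.\<close>

definition P_list :: "nat sgraph set \<Rightarrow> nat \<Rightarrow> nat" where
  "P_list \<G> k = min_u_list (SOME H. H \<in> \<G>) k"

definition permute_graph :: "('a \<Rightarrow> 'a) \<Rightarrow> 'a sgraph \<Rightarrow> 'a sgraph" where
  "permute_graph \<pi> H = \<lparr>verts = \<pi> ` verts H, edges = (\<lambda>e. \<pi> ` e) ` edges H\<rparr>"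

definition colored_graphs :: "nat sgraph set \<Rightarrow> nat \<Rightarrow> (nat sgraph \<times> (nat \<Rightarrow> nat)) set" where
  "colored_graphs \<G> k = {(H, f). H \<in> \<G> \<and> f \<in> list_colorings H (\<lambda>_. {1..k})}"

text \<open>For \<open>H\<close> in an unlabeled graph of order \<open>n\<close>, the permutations of \<open>verts H\<close> form \<open>S\<^sub>n\<close>.\<close>

definition colored_orbit :: "nat sgraph \<times> (nat \<Rightarrow> nat) \<Rightarrow> (nat sgraph \<times> (nat \<Rightarrow> nat)) set" where
  "colored_orbit = (\<lambda>(H, f). {(permute_graph \<pi> H, f \<circ> inv \<pi>) | \<pi>. \<pi> permutes verts H})"

definition P_unlabeled :: "nat sgraph set \<Rightarrow> nat \<Rightarrow> nat" where
  "P_unlabeled \<G> k = card (colored_orbit ` colored_graphs \<G> k)"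


subsection \<open>Well-definedness of \<open>P_list\<close>\<close>

lemma graph_isomorphism_inv:
  assumes "graph_isomorphism \<phi> G H"
  shows "graph_isomorphism (inv_into (verts G) \<phi>) H G"
proof -
  have b: "bij_betw \<phi> (verts G) (verts H)"
    using assms by (simp add: graph_isomorphism_def)
  have "inv_into (verts G) \<phi> u \<in> verts G" "\<phi> (inv_into (verts G) \<phi> u) = u" if "u \<in> verts H" for u
    using that b by (auto simp: bij_betw_def inv_into_into f_inv_into_f)
  then show ?thesis
    using assms bij_betw_inv_into[OF b] by (simp add: graph_isomorphism_def)
qed

lemma graph_isomorphism_comp:
  assumes "graph_isomorphism \<phi> G H" "graph_isomorphism \<psi> H K"
  shows "graph_isomorphism (\<psi> \<circ> \<phi>) G K"
  using assms unfolding graph_isomorphism_def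
  by (auto intro: bij_betw_trans dest: bij_betwE)

lemma unlabeled_nonempty:
  assumes "simple_graph G"
  shows "unlabeled G \<noteq> {}"
proof -
  have "finite (verts G)" using assms by (simp add: simple_graph_def)
  then obtain \<phi> where b: "bij_betw \<phi> (verts G) {1..card (verts G)}"
    using ex_bij_betw_finite_nat[of "verts G"] finite_same_card_bij[of "verts G" "{1..card (verts G)}"]
    by auto
  define H where "H = \<lparr>verts = {1..card (verts G)}, edges = (\<lambda>e. \<phi> ` e) ` edges G\<rparr>"
  have inj: "inj_on \<phi> (verts G)" and im: "\<And>v. v \<in> verts G \<Longrightarrow> \<phi> v \<in> {1..card (verts G)}"
    using b by (auto simp: bij_betw_def)
  have sub: "e \<subseteq> verts G" if "e \<in> edges G" for e
    using assms that by (auto simp: simple_graph_def)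
  have "adjacent G u v \<longleftrightarrow> adjacent H (\<phi> u) (\<phi> v)" if "u \<in> verts G" "v \<in> verts G" for u v
  proof
    assume "adjacent H (\<phi> u) (\<phi> v)"
    then have "\<phi> ` {u, v} \<in> (\<lambda>e. \<phi> ` e) ` edges G" by (simp add: H_def)
    then obtain e where e: "\<phi> ` {u, v} = \<phi> ` e" "e \<in> edges G" by (rule imageE)
    have "{u, v} = e"
      using inj_on_image_eq_iff[OF inj, of "{u, v}" e] sub[OF e(2)] that e(1) by simp
    then show "adjacent G u v" using e(2) by simp
  next
    assume "adjacent G u v"
    then have "\<phi> ` {u, v} \<in> (\<lambda>e. \<phi> ` e) ` edges G" by (rule imageI)
    then show "adjacent H (\<phi> u) (\<phi> v)" by (simp add: H_def)
  qed
  then have "isomorphic G H"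
    using b by (auto simp: isomorphic_def graph_isomorphism_def H_def)
  moreover have "simple_graph H"
    unfolding simple_graph_def
  proof (intro conjI subsetI)
    fix e assume "e \<in> edges H"
    then obtain d where d: "e = \<phi> ` d" "d \<in> edges G" by (auto simp: H_def)
    then obtain u v where "d = {u, v}" "u \<in> verts G" "v \<in> verts G" "u \<noteq> v"
      using assms unfolding simple_graph_def by blast
    then have "e = {\<phi> u, \<phi> v}" "\<phi> u \<in> verts H" "\<phi> v \<in> verts H" "\<phi> u \<noteq> \<phi> v"
      using d(1) im inj by (auto simp: H_def inj_on_eq_iff)
    then show "e \<in> {{u, v} | u v. u \<in> verts H \<and> v \<in> verts H \<and> u \<noteq> v}" by blast
  qed (simp add: H_def)
  ultimately have "H \<in> unlabeled G" by (simp add: unlabeled_def H_def)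
  then show ?thesis by blast
qed

lemma coloring_transfer:
  fixes \<phi> :: "'a \<Rightarrow> 'b"
  assumes iso: "graph_isomorphism \<phi> G H"
  defines "T \<equiv> \<lambda>f. restrict (f \<circ> \<phi>) (verts G)"
  shows "f \<in> list_colorings H L \<Longrightarrow> T f \<in> list_colorings G (L \<circ> \<phi>)"
    and "(f, g) \<in> coloring_equiv H L \<Longrightarrow> (T f, T g) \<in> coloring_equiv G (L \<circ> \<phi>)"
proof -
  have b: "bij_betw \<phi> (verts G) (verts H)"
    using iso by (simp add: graph_isomorphism_def)
  let ?i = "inv_into (verts G) \<phi>"
  have m: "\<phi> v \<in> verts H" if "v \<in> verts G" for v using b that by (auto simp: bij_betw_def)
  have A: "T f \<in> list_colorings G (L \<circ> \<phi>)" if "f \<in> list_colorings H L" for f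
    using that iso m by (auto simp: list_colorings_def T_def graph_isomorphism_def)
  then show "f \<in> list_colorings H L \<Longrightarrow> T f \<in> list_colorings G (L \<circ> \<phi>)" .
  show "(T f, T g) \<in> coloring_equiv G (L \<circ> \<phi>)" if fg: "(f, g) \<in> coloring_equiv H L"
  proof -
    obtain \<pi> where \<pi>: "\<pi> permutes verts H" "graph_isomorphism \<pi> H H" "f \<circ> \<pi> = g"
      using fg by (auto simp: coloring_equiv_def Aut_def)
    define \<rho> where "\<rho> = (\<lambda>v. if v \<in> verts G then (?i \<circ> (\<pi> \<circ> \<phi>)) v else v)"
    have i0: "graph_isomorphism (?i \<circ> (\<pi> \<circ> \<phi>)) G G"
      by (intro graph_isomorphism_comp[OF graph_isomorphism_comp[OF iso \<pi>(2)] graph_isomorphism_inv[OF iso]])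
    then have i1: "graph_isomorphism \<rho> G G"
      by (auto simp: graph_isomorphism_def \<rho>_def cong: bij_betw_cong)
    then have "\<rho> permutes verts G"
      by (intro bij_imp_permutes) (auto simp: graph_isomorphism_def \<rho>_def)
    then have "\<rho> \<in> Aut G" using i1 by (simp add: Aut_def)
    moreover have "T f \<circ> \<rho> = T g"
    proof
      fix v
      have "\<rho> v \<in> verts G" "\<phi> (\<rho> v) = \<pi> (\<phi> v)" if "v \<in> verts G"
      proof -
        have "\<pi> (\<phi> v) \<in> \<phi> ` verts G"
          using m[OF that] \<pi>(1) b by (simp add: bij_betw_def permutes_in_image)
        then show "\<rho> v \<in> verts G" "\<phi> (\<rho> v) = \<pi> (\<phi> v)"
          using that by (simp_all add: \<rho>_def inv_into_into f_inv_into_f)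
      qed
      then show "(T f \<circ> \<rho>) v = T g v"
        using \<pi>(3) by (cases "v \<in> verts G") (auto simp: T_def \<rho>_def)
    qed
    ultimately show ?thesis using fg A by (auto simp: coloring_equiv_def)
  qed
qed

lemma list_colorings_cong:
  assumes "\<And>v. v \<in> verts H \<Longrightarrow> L v = L' v"
  shows "list_colorings H L = list_colorings H L'"
  using assms by (auto simp: list_colorings_def PiE_iff)

lemma quotient_eq_image: "A // r = (\<lambda>a. r `` {a}) ` A"
  by (auto simp: quotient_def)

lemma u_list_transfer:
  fixes \<phi> :: "'a \<Rightarrow> 'b"
  assumes iso: "graph_isomorphism \<phi> G H"
  shows "u_list G (L \<circ> \<phi>) = u_list H L"
proof -
  have b: "bij_betw \<phi> (verts G) (verts H)"
    using iso by (simp add: graph_isomorphism_def)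
  let ?i = "inv_into (verts G) \<phi>"
  let ?A = "list_colorings H L" and ?r = "coloring_equiv H L"
  let ?B = "list_colorings G (L \<circ> \<phi>)" and ?s = "coloring_equiv G (L \<circ> \<phi>)"
  define T :: "('b \<Rightarrow> nat) \<Rightarrow> 'a \<Rightarrow> nat" where "T = (\<lambda>f. restrict (f \<circ> \<phi>) (verts G))"
  define S :: "('a \<Rightarrow> nat) \<Rightarrow> 'b \<Rightarrow> nat" where "S = (\<lambda>f. restrict (f \<circ> ?i) (verts H))"
  note iso' = graph_isomorphism_inv[OF iso]
  have i1: "?i u \<in> verts G" "\<phi> (?i u) = u" if "u \<in> verts H" for u
    using that b by (auto simp: bij_betw_def inv_into_into f_inv_into_f)
  have i2: "\<phi> v \<in> verts H" "?i (\<phi> v) = v" if "v \<in> verts G" for v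
    using that b by (auto simp: bij_betw_def)
  have lc: "list_colorings H (L \<circ> \<phi> \<circ> ?i) = ?A"
    by (rule list_colorings_cong) (simp add: i1)
  then have ce: "coloring_equiv H (L \<circ> \<phi> \<circ> ?i) = ?r"
    by (simp add: coloring_equiv_def)
  have T1: "T f \<in> ?B" if "f \<in> ?A" for f
    using coloring_transfer(1)[OF iso that] by (simp add: T_def)
  have T2: "(T f, T g) \<in> ?s" if "(f, g) \<in> ?r" for f g
    using coloring_transfer(2)[OF iso that] by (simp add: T_def)
  have S1: "S f \<in> ?A" if "f \<in> ?B" for f
    using coloring_transfer(1)[OF iso' that] lc by (simp add: S_def)
  have S2: "(S f, S g) \<in> ?r" if "(f, g) \<in> ?s" for f g
    using coloring_transfer(2)[OF iso' that] ce by (simp add: S_def)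
  have ST: "S (T f) = f" if "f \<in> ?A" for f
  proof
    fix u show "S (T f) u = f u"
      using that i1 by (cases "u \<in> verts H") (auto simp: S_def T_def list_colorings_def PiE_iff extensional_def)
  qed
  have TS: "T (S f) = f" if "f \<in> ?B" for f
  proof
    fix u show "T (S f) u = f u"
      using that i2 by (cases "u \<in> verts G") (auto simp: S_def T_def list_colorings_def PiE_iff extensional_def)
  qed
  have rA: "?r \<subseteq> ?A \<times> ?A" and sB: "?s \<subseteq> ?B \<times> ?B" by (auto simp: coloring_equiv_def)
  have cls: "T ` (?r `` {f}) = ?s `` {T f}" if f: "f \<in> ?A" for f
  proof (intro subset_antisym subsetI)
    fix g assume "g \<in> ?s `` {T f}"
    then have g: "(T f, g) \<in> ?s" by simp
    then have "(f, S g) \<in> ?r" using S2[OF g] ST[OF f] by simp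
    moreover have "g = T (S g)" using g sB TS by auto
    ultimately show "g \<in> T ` (?r `` {f})" by blast
  qed (use T2 in auto)
  have TA: "T ` ?A = ?B"
  proof (intro subset_antisym subsetI)
    fix g assume "g \<in> ?B"
    then show "g \<in> T ` ?A" using TS S1 by (metis imageI)
  qed (use T1 in auto)
  have "(\<lambda>C. T ` C) ` (?A // ?r) = (\<lambda>f. T ` (?r `` {f})) ` ?A"
    unfolding quotient_eq_image by (simp only: image_image)
  also have "\<dots> = (\<lambda>f. ?s `` {T f}) ` ?A"
    by (rule image_cong[OF refl cls])
  also have "\<dots> = (\<lambda>f. ?s `` {f}) ` T ` ?A"
    by (simp only: image_image)
  also have "\<dots> = ?B // ?s"
    by (simp only: TA quotient_eq_image)
  finally have eq: "?B // ?s = (\<lambda>C. T ` C) ` (?A // ?r)" ..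
  have "inj_on T ?A" by (rule inj_on_inverseI[of _ S]) (rule ST)
  then have "inj_on (\<lambda>C. T ` C) (?A // ?r)"
    by (rule inj_on_subset[OF inj_on_image_Pow]) (use rA in \<open>auto simp: quotient_def\<close>)
  then show ?thesis by (simp add: u_list_def eq card_image)
qed

lemma k_assignment_transfer:
  assumes iso: "graph_isomorphism \<phi> G H" and "k_assignment H k L"
  shows "\<exists>L'. k_assignment G k L' \<and> u_list H L = u_list G L'"
proof (intro exI conjI)
  have "\<phi> v \<in> verts H" if "v \<in> verts G" for v
    using iso that by (auto simp: graph_isomorphism_def bij_betw_def)
  then show "k_assignment G k (L \<circ> \<phi>)"
    using assms(2) by (simp add: k_assignment_def)
  show "u_list H L = u_list G (L \<circ> \<phi>)" by (rule u_list_transfer[OF iso, symmetric])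
qed

lemma min_u_list_isomorphic:
  assumes "isomorphic G H"
  shows "min_u_list G k = min_u_list H k"
proof -
  obtain \<phi> where iso: "graph_isomorphism \<phi> G H" using assms by (auto simp: isomorphic_def)
  have "(\<exists>L. k_assignment G k L \<and> m = u_list G L) = (\<exists>L. k_assignment H k L \<and> m = u_list H L)" for m
    using k_assignment_transfer[OF iso] k_assignment_transfer[OF graph_isomorphism_inv[OF iso]]
    by blast
  then show ?thesis by (simp add: min_u_list_def)
qed

lemma P_list_eq:
  assumes "H \<in> unlabeled G"
  shows "P_list (unlabeled G) k = min_u_list H k"
proof -
  have eq: "min_u_list G k = min_u_list K k" if "K \<in> unlabeled G" for K
    using that by (intro min_u_list_isomorphic) (simp add: unlabeled_def)
  have "(SOME K. K \<in> unlabeled G) \<in> unlabeled G" using assms by (rule someI)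
  from eq[OF this] eq[OF assms] show ?thesis by (simp add: P_list_def)
qed

end

theory Submission
  imports Defs Complex_Main
begin

text \<open>Since \<open>G\<close> is point-determining, \<open>{x, y}\<close> is the only pair of vertices of \<open>G'\<close> with equal
  neighborhoods, so an automorphism of \<open>G'\<close> is one of \<open>G\<close>, possibly followed by the swap of \<open>x\<close>
  and \<open>y\<close>. A proper coloring cannot be constant on a cycle containing an edge, hence only the identity
  and the swap can fix a coloring. Give a coloring \<open>f\<close> weight 1 if \<open>f x \<noteq> f y\<close> and both colors
  lie in both lists, and weight 2 otherwise; then every class has total weight at most \<open>2 |Aut G|\<close>,
  with equality if all lists coincide.

  For given colors of \<open>x\<close> and \<open>y\<close>, the number of extensions to \<open>G\<close> is, for large \<open>k\<close>, at least the
  number \<open>P(k - 1)\<close> or \<open>P(k - 2)\<close> of colorings of \<open>G\<close> from a constant list of that size (Donner's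
  theorem, proved by comparing the inclusion-exclusion expansions over edge sets: single edges gain order
  \<open>k\<^sup>n\<^sup>-\<^sup>2\<close> per missing common color, all larger edge sets together lose only order \<open>k\<^sup>n\<^sup>-\<^sup>3\<close>).
  If \<open>L x\<close> and \<open>L y\<close> share \<open>s\<close> colors, the total weight therefore exceeds that of the constant
  assignment by at least \<open>(k - s) ((k + s + 1) P(k - 2) - 2 P(k - 1))\<close>, which is nonnegative for
  large \<open>k\<close> because \<open>P(k - 1) / P(k - 2)\<close> is bounded.\<close>

subsection \<open>Inclusion-exclusion for list colorings\<close>

lemma simple_graph_edgeE:
  assumes "simple_graph G" "e \<in> edges G"
  obtains u v where "e = {u, v}" "u \<in> verts G" "v \<in> verts G" "u \<noteq> v"
  using assms unfolding simple_graph_def by blast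

lemma finite_edges:
  assumes "simple_graph G"
  shows "finite (edges G)"
proof (rule finite_subset)
  show "edges G \<subseteq> Pow (verts G)"
    using assms by (auto elim: simple_graph_edgeE)
  show "finite (Pow (verts G))"
    using assms by (simp add: simple_graph_def)
qed

lemma finite_list_colorings:
  assumes "finite (verts G)" "\<And>v. v \<in> verts G \<Longrightarrow> finite (L v)"
  shows "finite (list_colorings G L)"
  by (rule finite_subset[OF _ finite_PiE[OF assms]]) (auto simp: list_colorings_def)

definition monochromatic :: "('a \<Rightarrow> 'c) \<Rightarrow> 'a set \<Rightarrow> bool" where
  "monochromatic f e \<longleftrightarrow> (\<forall>u\<in>e. \<forall>v\<in>e. f u = f v)"

text \<open>For edges \<open>A\<close> on \<open>V\<close> these are the maps from the lists, not
  necessarily proper, that are constant on every component of \<open>(V, A)\<close>; they are what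
  the term of \<open>A\<close> in the inclusion-exclusion sum counts.\<close>

definition edge_constant :: "'a set \<Rightarrow> ('a \<Rightarrow> nat set) \<Rightarrow> 'a set set \<Rightarrow> ('a \<Rightarrow> nat) set" where
  "edge_constant V L A = {f \<in> Pi\<^sub>E V L. \<forall>e\<in>A. monochromatic f e}"

lemma list_colorings_eq_no_monochromatic:
  assumes "simple_graph G"
  shows "list_colorings G L = {f \<in> Pi\<^sub>E (verts G) L. \<forall>e\<in>edges G. \<not> monochromatic f e}"
proof -
  have "(\<forall>u\<in>verts G. \<forall>v\<in>verts G. adjacent G u v \<longrightarrow> f u \<noteq> f v)
      \<longleftrightarrow> (\<forall>e\<in>edges G. \<not> monochromatic f e)" (is "?l \<longleftrightarrow> ?r") for f :: "'a \<Rightarrow> nat"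
  proof
    assume ?l then show ?r
      using assms by (auto simp: monochromatic_def elim!: simple_graph_edgeE)
  next
    assume r: ?r
    show ?l
    proof (intro ballI impI)
      fix u v assume "adjacent G u v"
      with r have "\<not> monochromatic f {u, v}" by blast
      then show "f u \<noteq> f v" by (auto simp: monochromatic_def)
    qed
  qed
  then show ?thesis by (simp add: list_colorings_def)
qed

text \<open>Whitney's subset expansion with lists: the indicator of a proper coloring is the product
  over all edges of 1 minus the indicator of being monochromatic; multiply out and exchange the
  sums.\<close>

lemma card_list_colorings_inclusion_exclusion:
  assumes G: "simple_graph G" and fin: "\<And>v. v \<in> verts G \<Longrightarrow> finite (L v)"
  shows "real (card (list_colorings G L)) =
    (\<Sum>A\<in>Pow (edges G). (-1) ^ card A * real (card (edge_constant (verts G) L A)))"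
proof -
  let ?P = "Pi\<^sub>E (verts G) L"
  let ?m = "\<lambda>f e. of_bool (monochromatic f e) :: real"
  have finP: "finite ?P"
    using G fin by (intro finite_PiE) (auto simp: simple_graph_def)
  have prod_bool: "(\<Prod>e\<in>A. of_bool (P e)) = (of_bool (\<forall>e\<in>A. P e) :: real)" if "finite A" for A and P :: "'a set \<Rightarrow> bool"
    using that by (induction A) auto
  have card_eq: "real (card {f \<in> ?P. Q f}) = (\<Sum>f\<in>?P. of_bool (Q f))" for Q
    using finP by (simp add: sum.If_cases of_bool_def Int_def)
  have "real (card (list_colorings G L)) = (\<Sum>f\<in>?P. of_bool (\<forall>e\<in>edges G. \<not> monochromatic f e))"
    by (simp add: list_colorings_eq_no_monochromatic[OF G] card_eq)
  also have "\<dots> = (\<Sum>f\<in>?P. \<Prod>e\<in>edges G. 1 - ?m f e)"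
    using prod_bool[OF finite_edges[OF G]] by (intro sum.cong refl) (simp flip: of_bool_not_iff)
  also have "\<dots> = (\<Sum>f\<in>?P. \<Sum>A\<in>Pow (edges G). (-1) ^ card A * of_bool (\<forall>e\<in>A. monochromatic f e))"
    using finite_edges[OF G]
    by (intro sum.cong refl) (auto simp: prod_diff_conv_sum prod_bool finite_subset intro!: sum.cong)
  also have "\<dots> = (\<Sum>A\<in>Pow (edges G). (-1) ^ card A * (\<Sum>f\<in>?P. of_bool (\<forall>e\<in>A. monochromatic f e)))"
    by (subst sum.swap) (simp add: sum_distrib_left)
  finally show ?thesis
    by (simp add: edge_constant_def card_eq)
qed

section \<open>Connected components and contraction of edge sets\<close>

text \<open>\<open>r\<close> selects one vertex from each component of \<open>(V, A)\<close>. The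
  last property is connectivity in the form used later: a predicate that holds at the representative
  and fails at \<open>v\<close> must break along some edge of the same component.\<close>

lemma component_representatives:
  assumes V: "\<And>e. e \<in> A \<Longrightarrow> e \<subseteq> V"
  obtains r :: "'a \<Rightarrow> 'a" where
    "\<And>v. v \<in> V \<Longrightarrow> r v \<in> V"
    "\<And>v. r (r v) = r v"
    "\<And>u v. {u, v} \<in> A \<Longrightarrow> r u = r v"
    "\<And>P v. P (r v) \<Longrightarrow> \<not> P v \<Longrightarrow> \<exists>u w. {u, w} \<in> A \<and> P u \<and> \<not> P w \<and> r w = r v"
proof -
  define E where "E = {(u, v). {u, v} \<in> A}"
  define r where "r = (\<lambda>v. SOME w. (v, w) \<in> E\<^sup>*)"
  have sym: "(v, u) \<in> E\<^sup>*" if "(u, v) \<in> E\<^sup>*" for u v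
    using sym_rtrancl[of E] that by (auto simp: sym_def E_def insert_commute)
  have r: "(v, r v) \<in> E\<^sup>*" for v
    unfolding r_def by (rule someI[of _ v]) simp
  \<comment> \<open>Connected vertices reach the same vertices, so \<open>SOME\<close> makes the
    same choice for both.\<close>
  have r_eq: "r u = r v" if "(u, v) \<in> E\<^sup>*" for u v
  proof -
    have "(u, w) \<in> E\<^sup>* \<longleftrightarrow> (v, w) \<in> E\<^sup>*" for w
      using that sym[OF that] by (meson rtrancl_trans)
    then show ?thesis by (simp add: r_def)
  qed
  have walk: "\<exists>u w. {u, w} \<in> A \<and> P u \<and> \<not> P w \<and> (w, v) \<in> E\<^sup>*"
    if "(a, v) \<in> E\<^sup>*" "P a" "\<not> P v" for a v and P :: "'a \<Rightarrow> bool"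
    using that
  proof (induction rule: converse_rtrancl_induct)
    case (step y z)
    then show ?case by (cases "P z") (auto simp: E_def)
  qed simp
  show thesis
  proof (rule that[of r])
    show "r v \<in> V" if "v \<in> V" for v
      using r[of v]
    proof (cases rule: rtranclE)
      case (step y)
      then show ?thesis using V by (auto simp: E_def)
    qed (use that in simp)
    show "r (r v) = r v" for v using r_eq[OF r] by simp
    show "r u = r v" if "{u, v} \<in> A" for u v
      by (rule r_eq) (use that in \<open>auto simp: E_def\<close>)
    show "\<exists>u w. {u, w} \<in> A \<and> P u \<and> \<not> P w \<and> r w = r v" if "P (r v)" "\<not> P v" for P v
      using walk[OF sym[OF r], of P v] that r_eq by blast
  qed
qed

text \<open>The exponent \<open>c\<close> is the number of connected components of \<open>(V, A)\<close>.\<close>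

lemma edge_constant_contraction_bounds:
  fixes V :: "'a set"
  assumes fin: "finite V" "finite A" and A: "\<And>e. e \<in> A \<Longrightarrow> \<exists>u\<in>V. \<exists>v\<in>V. u \<noteq> v \<and> e = {u, v}"
  obtains c where
    "\<forall>L. (\<forall>v\<in>V. finite (L v) \<and> card (L v) = k) \<longrightarrow>
      card (edge_constant V L A) \<le> k ^ c \<and>
      k ^ c \<le> card (edge_constant V L A) + (\<Sum>e\<in>A. 2 * (k - card (\<Inter>(L ` e)))) * k ^ (c - 1)"
    "2 \<le> card A \<longrightarrow> c + 2 \<le> card V" "A \<noteq> {} \<longrightarrow> 1 \<le> c"
proof -
  have sub: "\<And>e. e \<in> A \<Longrightarrow> e \<subseteq> V" using A by blast
  obtain r where r: "\<And>v. v \<in> V \<Longrightarrow> r v \<in> V" "\<And>v. r (r v) = r v"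
    "\<And>u v. {u, v} \<in> A \<Longrightarrow> r u = r v"
    and walk: "\<And>P v. P (r v) \<Longrightarrow> \<not> P v \<Longrightarrow> \<exists>u w. {u, w} \<in> A \<and> P u \<and> \<not> P w \<and> r w = r v"
    by (rule component_representatives[OF sub], assumption, rule that) assumption+
  define W where "W = r ` V"
  have finW: "finite W" and WV: "W \<subseteq> V" using fin r by (auto simp: W_def)
  have rW: "r w = w" if "w \<in> W" for w using that r by (auto simp: W_def)
  show thesis
  proof (rule that[of "card W"]; (intro allI impI conjI)?)
    fix L :: "'a \<Rightarrow> nat set"
    assume "\<forall>v\<in>V. finite (L v) \<and> card (L v) = k"
    then have L: "\<And>v. v \<in> V \<Longrightarrow> finite (L v) \<and> card (L v) = k" by blast
    let ?F = "edge_constant V L A" and ?P = "Pi\<^sub>E W L"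
    have finP: "finite ?P"
      using finW WV L by (auto intro!: finite_PiE)
    have "(\<Prod>w\<in>W. card (L w)) = (\<Prod>w\<in>W. k)"
      using L WV by (intro prod.cong) auto
    then have cardP: "card ?P = k ^ card W"
      using finW by (simp add: card_PiE)
    have f_r: "f (r v) = f v" if "f \<in> ?F" for f v
    proof (rule ccontr)
      assume "f (r v) \<noteq> f v"
      then obtain u w where "{u, w} \<in> A" "f u \<noteq> f w"
        using walk[of "\<lambda>w. f w \<noteq> f v" v] by force
      with that show False by (auto simp: edge_constant_def monochromatic_def)
    qed
    have inj: "inj_on (\<lambda>f. restrict f W) ?F"
    proof (rule inj_onI)
      fix f g assume fg: "f \<in> ?F" "g \<in> ?F" "restrict f W = restrict g W"
      show "f = g"
      proof
        fix v show "f v = g v"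
        proof (cases "v \<in> V")
          case True
          then have "r v \<in> W" by (simp add: W_def)
          then have "f (r v) = g (r v)" using fg(3) by (metis restrict_apply')
          then show ?thesis using f_r[OF fg(1)] f_r[OF fg(2)] by metis
        qed (use fg in \<open>auto simp: edge_constant_def PiE_iff extensional_def\<close>)
      qed
    qed
    have "(\<lambda>f. restrict f W) ` ?F \<subseteq> ?P"
      using WV by (auto simp: edge_constant_def PiE_iff)
    then show "card ?F \<le> k ^ card W"
      using card_inj_on_le[OF inj _ finP] cardP by simp
    have finF: "finite ?F"
      using fin L by (auto simp: edge_constant_def intro!: finite_subset[OF _ finite_PiE[of V L]])
    \<comment> \<open>A coloring \<open>g\<close> of the representatives extends along \<open>r\<close> unless, on the way from \<open>r v\<close> to \<open>v\<close>,
      some edge \<open>e\<close> of \<open>A\<close> leaves the set of vertices whose list contains \<open>g (r v)\<close>.\<close>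
    define good where "good = {g \<in> ?P. \<forall>v\<in>V. g (r v) \<in> L v}"
    define bad where "bad = (\<lambda>e. {g \<in> ?P. \<exists>v\<in>e. g (r v) \<in> \<Union>(L ` e) - \<Inter>(L ` e)})"
    have "inj_on (\<lambda>g. restrict (g \<circ> r) V) good"
    proof (rule inj_onI)
      fix f g assume fg: "f \<in> good" "g \<in> good" "restrict (f \<circ> r) V = restrict (g \<circ> r) V"
      show "f = g"
      proof
        fix w show "f w = g w"
        proof (cases "w \<in> W")
          case True
          then have "(f \<circ> r) w = (g \<circ> r) w" using fg(3) WV by (metis restrict_apply' subsetD)
          then show ?thesis using rW True by simp
        qed (use fg in \<open>auto simp: good_def PiE_iff extensional_def\<close>)
      qed
    qed
    moreover have "(\<lambda>g. restrict (g \<circ> r) V) ` good \<subseteq> ?F"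
    proof (rule image_subsetI)
      fix g assume g: "g \<in> good"
      have "monochromatic (restrict (g \<circ> r) V) e" if "e \<in> A" for e
        using A[OF that] that r(3) by (auto simp: monochromatic_def insert_commute)
      then show "restrict (g \<circ> r) V \<in> ?F"
        using g by (auto simp: good_def edge_constant_def)
    qed
    ultimately have card_good: "card good \<le> card ?F"
      using card_inj_on_le finF by blast
    have cover: "?P \<subseteq> good \<union> (\<Union>e\<in>A. bad e)"
    proof
      fix g assume g: "g \<in> ?P"
      show "g \<in> good \<union> (\<Union>e\<in>A. bad e)"
      proof (cases "g \<in> good")
        case False
        then obtain v where v: "v \<in> V" "g (r v) \<notin> L v" using g by (auto simp: good_def)
        have "r v \<in> W" using v by (simp add: W_def)
        then have "g (r v) \<in> L (r v)" using g by (auto simp: PiE_iff)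
        then obtain u w where uw: "{u, w} \<in> A" "g (r v) \<in> L u" "g (r v) \<notin> L w" "r w = r v"
          using walk[of "\<lambda>w. g (r v) \<in> L w" v] v by blast
        then have "g \<in> bad {u, w}" using g by (auto simp: bad_def)
        then show ?thesis using uw(1) by blast
      qed simp
    qed
    \<comment> \<open>A bad \<open>g\<close> takes at the common representative \<open>w\<close> a
      value in the symmetric difference of the two lists, which has
      \<open>2 * (k - card (L u \<inter> L v))\<close> elements; the other \<open>card W - 1\<close>
      values are free.\<close>
    have card_bad: "card (bad e) \<le> 2 * (k - card (\<Inter>(L ` e))) * k ^ (card W - 1)" if e: "e \<in> A" for e
    proof -
      obtain u v where uv: "u \<in> V" "v \<in> V" "e = {u, v}" using A[OF e] by blast
      define w where "w = r v"
      have ru: "r u = w" using r(3) e uv by (simp add: w_def)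
      have w: "w \<in> W" using uv by (simp add: w_def W_def)
      define D where "D = \<Union>(L ` e) - \<Inter>(L ` e)"
      have D: "D = (L u - L u \<inter> L v) \<union> (L v - L u \<inter> L v)" by (auto simp: D_def uv)
      have "card D \<le> card (L u - L u \<inter> L v) + card (L v - L u \<inter> L v)"
        unfolding D by (rule card_Un_le)
      also have "\<dots> = 2 * (k - card (\<Inter>(L ` e)))"
        using L[of u] L[of v] uv by (simp add: card_Diff_subset del: Diff_Int2)
      finally have cD: "card D \<le> 2 * (k - card (\<Inter>(L ` e)))" .
      let ?Q = "Pi\<^sub>E W (L(w := D))"
      have finD: "finite D" using L uv by (auto simp: D)
      have "bad e \<subseteq> ?Q" using ru w by (auto simp: bad_def D_def uv PiE_iff extensional_def simp flip: w_def)
      then have "card (bad e) \<le> card ?Q"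
        by (rule card_mono[rotated]) (use finW WV L finD in \<open>auto intro!: finite_PiE\<close>)
      also have "\<dots> = card D * (\<Prod>v\<in>W - {w}. card (L v))"
        using finW w by (auto simp: card_PiE prod.remove[of W w])
      also have "(\<Prod>v\<in>W - {w}. card (L v)) = (\<Prod>v\<in>W - {w}. k)"
        using L WV by (intro prod.cong) auto
      also have "\<dots> = k ^ (card W - 1)" using w finW by simp
      finally show ?thesis using cD by (meson le_trans mult_le_mono1)
    qed
    have "k ^ card W = card ?P" using cardP ..
    also have "\<dots> \<le> card (good \<union> (\<Union>e\<in>A. bad e))"
      by (rule card_mono[OF _ cover], rule finite_subset[OF _ finP]) (auto simp: good_def bad_def)
    also have "\<dots> \<le> card good + card (\<Union>e\<in>A. bad e)" by (rule card_Un_le)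
    also have "card (\<Union>e\<in>A. bad e) \<le> (\<Sum>e\<in>A. card (bad e))" by (rule card_UN_le[OF fin(2)])
    also have "\<dots> \<le> (\<Sum>e\<in>A. 2 * (k - card (\<Inter>(L ` e))) * k ^ (card W - 1))"
      by (rule sum_mono) (rule card_bad)
    finally show "k ^ card W \<le> card ?F + (\<Sum>e\<in>A. 2 * (k - card (\<Inter>(L ` e)))) * k ^ (card W - 1)"
      using card_good by (simp add: sum_distrib_right)
  next
    assume "2 \<le> card A"
    then obtain e e' where e: "e \<in> A" "e' \<in> A" "e \<noteq> e'"
      by (metis card_2_iff' card_le_Suc0_iff_eq fin(2) not_less_eq_eq numeral_2_eq_2)
    obtain a b where ab: "a \<in> V" "b \<in> V" "a \<noteq> b" "e = {a, b}" using A[OF e(1)] by blast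
    obtain c d where cd: "c \<in> V" "d \<in> V" "c \<noteq> d" "e' = {c, d}" using A[OF e(2)] by blast
    have ra: "r a = r b" "r c = r d" using r(3) e ab cd by auto
    have "\<exists>p q. p \<in> V \<and> q \<in> V \<and> p \<noteq> q \<and> W \<subseteq> r ` (V - {p, q})"
    proof -
      have sub: "W \<subseteq> r ` (V - {p, q})" if "r p \<in> r ` (V - {p, q})" "r q \<in> r ` (V - {p, q})" for p q
        using that by (auto simp: W_def)
      show ?thesis
      proof (cases "b \<in> {c, d}")
        case False
        have *: "W \<subseteq> r ` (V - {a, q})"
          if q: "q \<in> {c, d}" "q \<noteq> a" and q': "q' \<in> {c, d}" "q' \<noteq> q" for q q'
        proof -
          have b: "r a \<in> r ` (V - {a, q})"
            using q ab ra False by (intro image_eqI[of _ _ b]) auto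
          have rq: "r q = r q'" using q q' ra by auto
          have "r q \<in> r ` (V - {a, q})"
          proof (cases "q' = a")
            case True then show ?thesis using b rq by simp
          next
            case False then show ?thesis using rq cd q' by (intro image_eqI[of _ _ q']) auto
          qed
          then show ?thesis using sub b by blast
        qed
        show ?thesis
        proof (cases "c = a")
          case True
          then show ?thesis using *[of d c] ab cd by auto
        next
          case False
          then show ?thesis using *[of c d] ab cd by auto
        qed
      next
        case True
        define q where "q = (if b = c then d else c)"
        have q: "q \<in> {c, d}" "q \<noteq> b" "r q = r b" and eq: "e' = {b, q}"
          using True cd ra by (auto simp: q_def)
        have "q \<noteq> a" using eq e(3) ab(4) by auto
        have "W \<subseteq> r ` (V - {a, q})"
          using q \<open>q \<noteq> a\<close> ab ra by (intro sub) (auto intro!: image_eqI[of _ _ b])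
        moreover have "q \<in> V" using q cd by auto
        ultimately show ?thesis using \<open>q \<noteq> a\<close> ab(1) by (intro exI[of _ a] exI[of _ q]) simp
      qed
    qed
    then obtain p q where pq: "p \<in> V" "q \<in> V" "p \<noteq> q" "W \<subseteq> r ` (V - {p, q})" by blast
    have "card W \<le> card (r ` (V - {p, q}))" by (rule card_mono[OF _ pq(4)]) (use fin in simp)
    also have "\<dots> \<le> card (V - {p, q})" using fin by (intro card_image_le) simp
    also have "\<dots> = card V - 2" using pq fin by (simp add: card_Diff_subset)
    finally have "card W \<le> card V - 2" .
    moreover have "2 \<le> card V" using card_mono[of V "{p, q}"] pq fin by simp
    ultimately show "card W + 2 \<le> card V" by simp
  next
    assume "A \<noteq> {}"
    then have "W \<noteq> {}" using A by (fastforce simp: W_def)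
    then show "1 \<le> card W" using finW by (simp add: Suc_le_eq card_gt_0_iff)
  qed
qed

text \<open>Contracting the edge merges \<open>v\<close> into \<open>u\<close>, and the merged
  vertex has the list \<open>L u \<inter> L v\<close>. An exact value is needed here, since single
  edges carry the main term of the comparison.\<close>

lemma card_edge_constant_single:
  assumes fin: "finite V" and uv: "u \<in> V" "v \<in> V" "u \<noteq> v"
    and L: "\<And>w. w \<in> V \<Longrightarrow> finite (L w) \<and> card (L w) = k"
  shows "card (edge_constant V L {{u, v}}) = card (L u \<inter> L v) * k ^ (card V - 2)"
proof -
  let ?Q = "Pi\<^sub>E (V - {v}) (L(u := L u \<inter> L v))"
  let ?F = "edge_constant V L {{u, v}}"
  have F: "f \<in> ?F \<longleftrightarrow> (\<forall>w\<in>V. f w \<in> L w) \<and> (\<forall>w. w \<notin> V \<longrightarrow> f w = undefined) \<and> f u = f v" for f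
    by (auto simp: edge_constant_def monochromatic_def PiE_iff extensional_def)
  have "bij_betw (\<lambda>f. restrict f (V - {v})) ?F ?Q"
  proof (rule bij_betw_byWitness[where f' = "\<lambda>f. f(v := f u)"])
    show "\<forall>f\<in>?F. (restrict f (V - {v}))(v := restrict f (V - {v}) u) = f"
      using uv by (auto simp: F fun_eq_iff restrict_def)
    show "\<forall>f\<in>?Q. restrict (f(v := f u)) (V - {v}) = f"
      by (auto simp: PiE_iff extensional_def fun_eq_iff)
    show "(\<lambda>f. restrict f (V - {v})) ` ?F \<subseteq> ?Q"
    proof (rule image_subsetI)
      fix f assume "f \<in> ?F"
      then have f: "\<And>w. w \<in> V \<Longrightarrow> f w \<in> L w" "f u = f v" by (simp_all add: F)
      have "f w \<in> (L(u := L u \<inter> L v)) w" if "w \<in> V - {v}" for w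
        using f(1)[of w] f(1)[of v] f(2) uv that by auto
      then show "restrict f (V - {v}) \<in> ?Q" by simp
    qed
    show "(\<lambda>f. f(v := f u)) ` ?Q \<subseteq> ?F"
    proof (rule image_subsetI)
      fix f assume f: "f \<in> ?Q"
      then have f': "\<And>w. w \<in> V - {v} \<Longrightarrow> f w \<in> (L(u := L u \<inter> L v)) w" "\<And>w. w \<notin> V - {v} \<Longrightarrow> f w = undefined"
        by (auto simp: PiE_iff extensional_def)
      have "(f(v := f u)) w \<in> L w" if "w \<in> V" for w
        using f'(1)[of u] f'(1)[of w] uv that by (auto split: if_splits)
      moreover have "(f(v := f u)) w = undefined" if "w \<notin> V" for w
        using f'(2)[of w] uv that by auto
      ultimately show "f(v := f u) \<in> ?F" using uv by (simp add: F)
    qed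
  qed
  then have "card (edge_constant V L {{u, v}}) = card ?Q" by (rule bij_betw_same_card)
  also have "\<dots> = card (L u \<inter> L v) * (\<Prod>w\<in>V - {v} - {u}. card (L w))"
    using fin uv prod.remove[of "V - {v}" u "\<lambda>w. card ((L(u := L u \<inter> L v)) w)"]
    by (simp add: card_PiE)
  also have "(\<Prod>w\<in>V - {v} - {u}. card (L w)) = (\<Prod>w\<in>V - {v} - {u}. k)"
    using L by (intro prod.cong) auto
  also have "(\<Prod>w\<in>V - {v} - {u}. k) = k ^ (card V - 2)"
    using fin uv by (simp add: numeral_2_eq_2)
  finally show ?thesis .
qed

subsection \<open>Constant lists minimize the number of list colorings\<close>

text \<open>The expansions are compared set by set. An edge lacking \<open>\<delta> e\<close> common
  colors gains \<open>\<delta> e * t\<close>, in total \<open>D * t\<close>. A set of at least two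
  edges changes its term by at most \<open>2 * D * k ^ (c - 1)\<close> with
  \<open>c + 2 \<le> card (verts G)\<close>. There are at most \<open>2 ^ card (edges G)\<close>
  such sets, so the bound on \<open>k\<close> keeps their total loss below \<open>D * k ^ c\<close>
  for the largest \<open>c\<close>, hence at most \<open>D * t\<close>.\<close>

theorem card_list_colorings_ge_constant:
  assumes G: "simple_graph G" and k: "2 * 2 ^ card (edges G) \<le> k"
    and L: "\<And>v. v \<in> verts G \<Longrightarrow> finite (L v) \<and> card (L v) = k"
    and B: "finite B" "card B = k"
  shows "card (list_colorings G (\<lambda>_. B)) \<le> card (list_colorings G L)"
proof -
  let ?V = "verts G" and ?E = "edges G"
  define F where "F A = real (card (edge_constant ?V L A))" for A
  define F0 where "F0 A = real (card (edge_constant ?V (\<lambda>_. B) A))" for A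
  define \<delta> where "\<delta> e = k - card (\<Inter>(L ` e))" for e
  define D where "D = real (\<Sum>e\<in>?E. \<delta> e)"
  define t where "t = real (k ^ (card ?V - 2))"
  \<comment> \<open>With this sign, the sum of \<open>\<Delta>\<close> over all edge sets is the
    difference of the two numbers of colorings.\<close>
  define \<Delta> where "\<Delta> A = (-1) ^ card A * (F A - F0 A)" for A
  have finV: "finite ?V" using G by (simp add: simple_graph_def)
  note finE = finite_edges[OF G]
  have B': "finite B \<and> card B = k" using B by simp
  have D0: "0 \<le> D" and t0: "0 \<le> t" by (simp_all add: D_def t_def sum_nonneg)
  have empty: "\<Delta> {} = 0"
  proof -
    have "(\<Prod>v\<in>?V. card (L v)) = (\<Prod>v\<in>?V. k)" using L by (intro prod.cong) auto
    then show ?thesis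
      using finV B by (simp add: \<Delta>_def F_def F0_def edge_constant_def card_PiE)
  qed
  have single: "\<Delta> {e} = \<delta> e * t" if e: "e \<in> ?E" for e
  proof -
    obtain u v where uv: "e = {u, v}" "u \<in> ?V" "v \<in> ?V" "u \<noteq> v"
      using simple_graph_edgeE[OF G e] by blast
    have "card (L u \<inter> L v) \<le> k" using L[OF uv(2)] card_mono[of "L u" "L u \<inter> L v"] by auto
    moreover have "F {e} = card (L u \<inter> L v) * t"
      using card_edge_constant_single[OF finV uv(2-4) L] by (simp add: F_def uv(1) t_def)
    moreover have "F0 {e} = k * t"
      using card_edge_constant_single[OF finV uv(2-4), of "\<lambda>_. B" k] B
      by (simp add: F0_def uv(1) t_def)
    ultimately show ?thesis by (simp add: \<Delta>_def \<delta>_def uv(1) of_nat_diff algebra_simps)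
  qed
  \<comment> \<open>The factor \<open>2 ^ card ?E\<close> stands in for a division: each larger set
    may use up one part in \<open>2 ^ card ?E\<close> of the gain \<open>D * t\<close>.\<close>
  have many: "- (D * t) \<le> 2 ^ card ?E * \<Delta> A" if A: "A \<subseteq> ?E" "2 \<le> card A" for A
  proof -
    have finA: "finite A" using A finE finite_subset by blast
    have A': "\<exists>u\<in>?V. \<exists>v\<in>?V. u \<noteq> v \<and> e = {u, v}" if "e \<in> A" for e
      using simple_graph_edgeE[OF G, of e] A that by blast
    obtain c where
      bounds: "\<forall>L. (\<forall>v\<in>?V. finite (L v) \<and> card (L v) = k) \<longrightarrow>
        card (edge_constant ?V L A) \<le> k ^ c \<and>
        k ^ c \<le> card (edge_constant ?V L A) + (\<Sum>e\<in>A. 2 * (k - card (\<Inter>(L ` e)))) * k ^ (c - 1)"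
      and c: "2 \<le> card A \<longrightarrow> c + 2 \<le> card ?V" "A \<noteq> {} \<longrightarrow> 1 \<le> c"
      by (rule edge_constant_contraction_bounds[OF finV finA A'])
    have c': "c + 2 \<le> card ?V" "1 \<le> c" using c A by auto
    \<comment> \<open>With constant lists no edge lacks a common color, so the upper and the lower
      bound coincide and the term is exactly \<open>k ^ c\<close>.\<close>
    have "card (\<Inter>e\<in>e. B) = k" if "e \<in> A" for e :: "'a set"
      using A'[OF that] B by auto
    then have "F0 A = real k ^ c"
      using bounds[rule_format, of "\<lambda>_. B"] B' by (simp add: F0_def)
    then have F0: "F A \<le> F0 A" and "F0 A \<le> F A + (\<Sum>e\<in>A. 2 * real (\<delta> e)) * real k ^ (c - 1)"
    proof -
      have "card (edge_constant ?V L A) \<le> k ^ c"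
        and low: "k ^ c \<le> card (edge_constant ?V L A) + (\<Sum>e\<in>A. 2 * \<delta> e) * k ^ (c - 1)"
        using bounds[rule_format, of L] L by (simp_all add: \<delta>_def)
      then show "F A \<le> F0 A"
        by (simp add: F_def \<open>F0 A = real k ^ c\<close> flip: of_nat_power)
      have "real (k ^ c) \<le> real (card (edge_constant ?V L A) + (\<Sum>e\<in>A. 2 * \<delta> e) * k ^ (c - 1))"
        using low by (rule of_nat_mono)
      then show "F0 A \<le> F A + (\<Sum>e\<in>A. 2 * real (\<delta> e)) * real k ^ (c - 1)"
        by (simp add: F_def \<open>F0 A = real k ^ c\<close>)
    qed
    moreover have "(\<Sum>e\<in>A. 2 * real (\<delta> e)) * real k ^ (c - 1) \<le> 2 * D * real k ^ (c - 1)"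
    proof (rule mult_right_mono)
      show "(\<Sum>e\<in>A. 2 * real (\<delta> e)) \<le> 2 * D"
        unfolding D_def of_nat_sum sum_distrib_left by (rule sum_mono2[OF finE A(1)]) simp
    qed simp
    ultimately have "\<bar>F A - F0 A\<bar> \<le> 2 * D * real k ^ (c - 1)"
      by linarith
    then have "2 ^ card ?E * \<bar>F A - F0 A\<bar> \<le> 2 ^ card ?E * (2 * D * real k ^ (c - 1))"
      by (rule mult_left_mono) simp
    also have "\<dots> = (2 * 2 ^ card ?E) * (D * real k ^ (c - 1))" by simp
    also have "\<dots> \<le> real k * (D * real k ^ (c - 1))"
      using of_nat_mono[OF k, where 'a = real] D0 by (intro mult_right_mono) simp_all
    also have "\<dots> = D * real k ^ c"
      using c' by (cases c) simp_all
    also have "\<dots> \<le> D * t"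
    proof -
      have "1 \<le> k" using k by (cases k) auto
      then show ?thesis
        using D0 c' by (auto simp: t_def intro!: mult_left_mono power_increasing)
    qed
    finally have "\<bar>2 ^ card ?E * \<Delta> A\<bar> \<le> D * t"
      by (simp add: \<Delta>_def abs_mult power_abs)
    then show ?thesis by linarith
  qed
  define M where "M = {A \<in> Pow ?E. 2 \<le> card A}"
  have finM: "finite M" using finE by (simp add: M_def)
  have "card M \<le> card (Pow ?E)" using finE by (intro card_mono) (auto simp: M_def)
  then have "card M \<le> 2 ^ card ?E" using finE by (simp add: card_Pow)
  then have cardM: "real (card M) \<le> 2 ^ card ?E"
    using of_nat_mono[of "card M" "2 ^ card ?E", where 'a = real] by simp
  have split: "Pow ?E = insert {} ((\<lambda>e. {e}) ` ?E \<union> M)"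
  proof (intro subset_antisym subsetI)
    fix A assume A: "A \<in> Pow ?E"
    then have "finite A" using finE finite_subset by blast
    then consider "card A = 0" | "card A = 1" | "2 \<le> card A" by linarith
    then show "A \<in> insert {} ((\<lambda>e. {e}) ` ?E \<union> M)"
      using A \<open>finite A\<close> by cases (auto simp: M_def card_1_singleton_iff)
  qed (auto simp: M_def)
  have "(\<Sum>A\<in>Pow ?E. \<Delta> A) = (\<Sum>A\<in>(\<lambda>e. {e}) ` ?E \<union> M. \<Delta> A)"
    unfolding split by (subst sum.insert) (use finE finM empty in \<open>auto simp: M_def\<close>)
  also have "\<dots> = (\<Sum>A\<in>(\<lambda>e. {e}) ` ?E. \<Delta> A) + (\<Sum>A\<in>M. \<Delta> A)"
    by (rule sum.union_disjoint) (use finE finM in \<open>auto simp: M_def\<close>)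
  also have "(\<Sum>A\<in>(\<lambda>e. {e}) ` ?E. \<Delta> A) = D * t"
    using single by (simp add: sum.reindex D_def sum_distrib_right)
  finally have sum: "(\<Sum>A\<in>Pow ?E. \<Delta> A) = D * t + (\<Sum>A\<in>M. \<Delta> A)" .
  have "2 ^ card ?E * - (D * t) \<le> real (card M) * - (D * t)"
    using cardM D0 t0 by (simp add: mult_right_mono)
  also have "\<dots> = (\<Sum>A\<in>M. - (D * t))" by simp
  also have "\<dots> \<le> (\<Sum>A\<in>M. 2 ^ card ?E * \<Delta> A)"
    by (rule sum_mono) (use many in \<open>auto simp: M_def\<close>)
  also have "\<dots> = 2 ^ card ?E * (\<Sum>A\<in>M. \<Delta> A)" by (simp add: sum_distrib_left)
  finally have "- (D * t) \<le> (\<Sum>A\<in>M. \<Delta> A)" by (simp only: mult_le_cancel_left) simp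
  then have "0 \<le> (\<Sum>A\<in>Pow ?E. \<Delta> A)" using sum by linarith
  also have "\<dots> = real (card (list_colorings G L)) - real (card (list_colorings G (\<lambda>_. B)))"
    using card_list_colorings_inclusion_exclusion[OF G, of L]
      card_list_colorings_inclusion_exclusion[OF G, of "\<lambda>_. B"] L B
    by (simp add: \<Delta>_def F_def F0_def right_diff_distrib sum_subtractf)
  finally show ?thesis by simp
qed

lemma list_colorings_mono:
  assumes "\<And>v. v \<in> verts G \<Longrightarrow> L v \<subseteq> L' v"
  shows "list_colorings G L \<subseteq> list_colorings G L'"
  using assms by (auto simp: list_colorings_def PiE_iff)

text \<open>Removing the colors of \<open>x\<close> and \<open>y\<close> leaves lists of possibly
  different sizes. Cutting each down to exactly \<open>k\<close> colors can only lose
  colorings.\<close>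

corollary card_list_colorings_ge_constant':
  assumes G: "simple_graph G" and k: "2 * 2 ^ card (edges G) \<le> k"
    and L: "\<And>v. v \<in> verts G \<Longrightarrow> finite (L v) \<and> k \<le> card (L v)"
    and B: "finite B" "card B = k"
  shows "card (list_colorings G (\<lambda>_. B)) \<le> card (list_colorings G L)"
proof -
  have "\<forall>v\<in>verts G. \<exists>T. T \<subseteq> L v \<and> card T = k \<and> finite T"
    using L by (metis obtain_subset_with_card_n)
  then obtain T where T: "\<And>v. v \<in> verts G \<Longrightarrow> T v \<subseteq> L v \<and> card (T v) = k \<and> finite (T v)"
    by metis
  have "card (list_colorings G (\<lambda>_. B)) \<le> card (list_colorings G T)"
    using T by (intro card_list_colorings_ge_constant[OF G k _ B]) auto
  also have "\<dots> \<le> card (list_colorings G L)"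
    using G L T by (intro card_mono finite_list_colorings list_colorings_mono) (auto simp: simple_graph_def)
  finally show ?thesis .
qed

section \<open>Growth of the number of colorings when one color is added\<close>

text \<open>With \<open>n\<close> vertices, there are at most \<open>(k + 1) ^ n\<close> colorings
  from \<open>C\<close>, and at least \<open>(k - n) ^ n\<close> from \<open>B\<close> because
  injective maps are proper. Since \<open>k + 1 \<le> 2 * (k - n)\<close>, the ratio is at most
  \<open>2 ^ n\<close>. The factor \<open>k + 3\<close> becomes \<open>k + 1\<close> when the lemma
  is applied to \<open>k - 2\<close>.\<close>

lemma card_colorings_Suc_le:
  assumes G: "simple_graph G" and B: "finite B" "card B = k" and C: "finite C" "card C = Suc k"
    and k: "2 * card (verts G) < k" "2 * 2 ^ card (verts G) \<le> k"
  shows "2 * card (list_colorings G (\<lambda>_. C)) \<le> (k + 3) * card (list_colorings G (\<lambda>_. B))"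
proof -
  let ?V = "verts G" and ?n = "card (verts G)"
  have finV: "finite ?V" using G by (simp add: simple_graph_def)
  have "card (list_colorings G (\<lambda>_. C)) \<le> card (?V \<rightarrow>\<^sub>E C)"
    using finV C by (intro card_mono finite_PiE) (auto simp: list_colorings_def)
  also have "\<dots> = Suc k ^ ?n" using finV C by (simp add: card_funcsetE)
  also have "\<dots> \<le> (2 * (k - ?n)) ^ ?n" using k by (intro power_mono) auto
  also have "\<dots> = 2 ^ ?n * (k - ?n) ^ ?n" by (rule power_mult_distrib)
  also have "(k - ?n) ^ ?n \<le> card (list_colorings G (\<lambda>_. B))"
  proof -
    have "(k - ?n) ^ ?n = (\<Prod>i\<in>{0..<?n}. k - ?n)" by simp
    also have "\<dots> \<le> (\<Prod>i\<in>{0..<?n}. k - i)" by (intro prod_mono) auto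
    also have "\<dots> = card {f \<in> ?V \<rightarrow>\<^sub>E B. inj_on f ?V}"
      using card_inj_on_subset_funcset[OF finV B(1) order.refl] B by simp
    also have "\<dots> \<le> card (list_colorings G (\<lambda>_. B))"
    proof (intro card_mono finite_list_colorings subsetI)
      fix f assume f: "f \<in> {f \<in> ?V \<rightarrow>\<^sub>E B. inj_on f ?V}"
      have "f u \<noteq> f v" if "u \<in> ?V" "v \<in> ?V" "adjacent G u v" for u v
      proof -
        have "u \<noteq> v"
          by (rule simple_graph_edgeE[OF G that(3)]) (auto simp: doubleton_eq_iff)
        then show ?thesis using f that by (auto dest: inj_onD)
      qed
      then show "f \<in> list_colorings G (\<lambda>_. B)" using f by (simp add: list_colorings_def)
    qed (use finV B in auto)
    finally show ?thesis .
  qed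
  finally have "2 * card (list_colorings G (\<lambda>_. C)) \<le> 2 * 2 ^ ?n * card (list_colorings G (\<lambda>_. B))"
    by simp
  also have "\<dots> \<le> (k + 3) * card (list_colorings G (\<lambda>_. B))"
    using k by (intro mult_right_mono) auto
  finally show ?thesis .
qed

subsection \<open>Automorphisms and equivalence of colorings\<close>

lemma id_in_Aut: "id \<in> Aut H"
  by (simp add: Aut_def graph_isomorphism_def permutes_id)

lemma Aut_comp: "\<pi> \<in> Aut H \<Longrightarrow> \<rho> \<in> Aut H \<Longrightarrow> \<pi> \<circ> \<rho> \<in> Aut H"
  by (auto simp: Aut_def intro: permutes_compose graph_isomorphism_comp)

lemma Aut_inv:
  assumes "\<pi> \<in> Aut H"
  shows "inv \<pi> \<in> Aut H"
proof -
  have p: "\<pi> permutes verts H" and i: "graph_isomorphism \<pi> H H"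
    using assms by (auto simp: Aut_def)
  have "adjacent H u v \<longleftrightarrow> adjacent H (inv \<pi> u) (inv \<pi> v)" if "u \<in> verts H" "v \<in> verts H" for u v
    using i that p permutes_in_image[OF permutes_inv[OF p]] permutes_inverses(1)[OF p]
    by (metis graph_isomorphism_def)
  then show ?thesis
    using permutes_inv[OF p] by (auto simp: Aut_def graph_isomorphism_def permutes_imp_bij)
qed

lemma finite_Aut: "finite (verts H) \<Longrightarrow> finite (Aut H)"
  by (rule finite_subset[OF _ finite_permutations]) (auto simp: Aut_def)

lemma Aut_in_verts: "\<pi> \<in> Aut H \<Longrightarrow> \<pi> v \<in> verts H \<longleftrightarrow> v \<in> verts H"
  by (simp add: Aut_def permutes_in_image)

lemma Aut_adjacent: "\<pi> \<in> Aut H \<Longrightarrow> u \<in> verts H \<Longrightarrow> v \<in> verts H \<Longrightarrow>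
  adjacent H (\<pi> u) (\<pi> v) \<longleftrightarrow> adjacent H u v"
  by (simp add: Aut_def graph_isomorphism_def)

text \<open>The common list matters: for general lists \<open>f \<circ> \<pi>\<close> may leave
  them, so a class can be smaller than the orbit of \<open>f\<close> under
  \<open>Aut H\<close>.\<close>

lemma coloring_comp_Aut:
  assumes "f \<in> list_colorings H (\<lambda>_. B)" "\<pi> \<in> Aut H"
  shows "f \<circ> \<pi> \<in> list_colorings H (\<lambda>_. B)"
  using assms Aut_in_verts[OF assms(2)] Aut_adjacent[OF assms(2)]
  by (auto simp: list_colorings_def PiE_iff extensional_def)

lemma equiv_coloring_equiv: "equiv (list_colorings H L) (coloring_equiv H L)"
proof (rule equivI)
  show "coloring_equiv H L \<subseteq> list_colorings H L \<times> list_colorings H L"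
    by (auto simp: coloring_equiv_def)
  show "refl_on (list_colorings H L) (coloring_equiv H L)"
    by (auto simp: coloring_equiv_def refl_on_def intro: bexI[OF _ id_in_Aut])
  show "sym (coloring_equiv H L)"
  proof (rule symI)
    fix f g assume "(f, g) \<in> coloring_equiv H L"
    then obtain \<pi> where "f \<in> list_colorings H L" "g \<in> list_colorings H L" and \<pi>: "\<pi> \<in> Aut H" "g = f \<circ> \<pi>"
      by (auto simp: coloring_equiv_def)
    moreover have "g \<circ> inv \<pi> = f"
      using \<pi> permutes_inv_o(1)[of \<pi> "verts H"] by (auto simp: Aut_def comp_assoc)
    ultimately show "(g, f) \<in> coloring_equiv H L"
      using Aut_inv by (auto simp: coloring_equiv_def)
  qed
  show "trans (coloring_equiv H L)"
  proof (rule transI)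
    fix f g h assume "(f, g) \<in> coloring_equiv H L" "(g, h) \<in> coloring_equiv H L"
    then obtain \<pi> \<rho> where "\<pi> \<in> Aut H" "\<rho> \<in> Aut H" "f \<circ> \<pi> = g" "g \<circ> \<rho> = h"
      "f \<in> list_colorings H L" "h \<in> list_colorings H L"
      by (auto simp: coloring_equiv_def)
    then show "(f, h) \<in> coloring_equiv H L"
      using Aut_comp[of \<pi> H \<rho>] by (auto simp: coloring_equiv_def comp_assoc)
  qed
qed

subsection \<open>Automorphisms of the join with two independent vertices\<close>

locale rigid_join =
  fixes G :: "'a sgraph" and x y :: 'a
  assumes simple: "simple_graph G"
    and pd: "point_determining G"
    and rigid: "\<forall>\<pi>\<in>Aut G. \<pi> \<noteq> id \<longrightarrow>
      (\<exists>C\<in>cycles_of \<pi> (verts G). \<exists>u\<in>C. \<exists>v\<in>C. adjacent G u v)"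
    and x: "x \<notin> verts G" and y: "y \<notin> verts G" and xy: "x \<noteq> y"
begin

abbreviation V where "V \<equiv> verts G"
abbreviation G' where "G' \<equiv> add_two_vertices G x y"
abbreviation \<tau> where "\<tau> \<equiv> transpose x y"

lemma finV: "finite V"
  using simple by (simp add: simple_graph_def)

lemma verts_join: "verts G' = insert x (insert y V)"
  by (auto simp: add_two_vertices_def)

lemma adjacent_in_V: "adjacent G u v \<Longrightarrow> u \<in> V \<and> v \<in> V \<and> u \<noteq> v"
  by (erule simple_graph_edgeE[OF simple]) (auto simp: doubleton_eq_iff)

lemma adjacent_join:
  "adjacent G' u v \<longleftrightarrow> adjacent G u v \<or> u \<in> {x, y} \<and> v \<in> V \<or> v \<in> {x, y} \<and> u \<in> V"
  by (auto simp: add_two_vertices_def doubleton_eq_iff)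

lemma simple_join: "simple_graph G'"
  unfolding simple_graph_def
proof (intro conjI subsetI)
  show "finite (verts G')" using finV by (simp add: verts_join)
  fix e assume "e \<in> edges G'"
  then have "\<exists>u\<in>verts G'. \<exists>v\<in>verts G'. e = {u, v} \<and> u \<noteq> v"
    unfolding verts_join using x y simple_graph_edgeE[OF simple, of e]
    by (auto simp: add_two_vertices_def)
  then show "e \<in> {{u, v} |u v. u \<in> verts G' \<and> v \<in> verts G' \<and> u \<noteq> v}" by blast
qed

lemma Aut_fixes: "\<rho> \<in> Aut G \<Longrightarrow> v \<notin> V \<Longrightarrow> \<rho> v = v"
  by (auto simp: Aut_def intro: permutes_not_in)

lemma transpose_fixes: "v \<in> V \<Longrightarrow> \<tau> v = v"
  using x y by (auto simp: transpose_def)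

lemma transpose_Aut_join: "\<tau> \<in> Aut G'"
proof -
  have p: "\<tau> permutes verts G'" by (rule permutes_swap_id) (simp_all add: verts_join)
  have "adjacent G' (\<tau> u) (\<tau> v) \<longleftrightarrow> adjacent G' u v" if "u \<in> verts G'" "v \<in> verts G'" for u v
    using that x y adjacent_in_V[of u v] adjacent_in_V[of "\<tau> u" "\<tau> v"]
    by (auto simp: adjacent_join verts_join transpose_def)
  then show ?thesis
    using p by (simp add: Aut_def graph_isomorphism_def permutes_imp_bij)
qed

lemma Aut_subset_join: "Aut G \<subseteq> Aut G'"
proof
  fix \<rho> assume \<rho>: "\<rho> \<in> Aut G"
  then have p: "\<rho> permutes verts G'"
    by (auto simp: Aut_def verts_join intro: permutes_subset)
  have "adjacent G' (\<rho> u) (\<rho> v) \<longleftrightarrow> adjacent G' u v" if uv: "u \<in> verts G'" "v \<in> verts G'" for u v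
  proof -
    have "adjacent G (\<rho> u) (\<rho> v) \<longleftrightarrow> adjacent G u v"
      using Aut_adjacent[OF \<rho>] Aut_in_verts[OF \<rho>] adjacent_in_V by blast
    moreover have "\<rho> w \<in> {x, y} \<longleftrightarrow> w \<in> {x, y}" if "w \<in> verts G'" for w
      using Aut_in_verts[OF \<rho>, of w] Aut_fixes[OF \<rho>, of w] that x y by (cases "w \<in> V") (auto simp: verts_join)
    ultimately show ?thesis
      using Aut_in_verts[OF \<rho>] uv unfolding adjacent_join by metis
  qed
  then show "\<rho> \<in> Aut G'"
    using p by (simp add: Aut_def graph_isomorphism_def permutes_imp_bij)
qed

text \<open>\<open>x\<close> and \<open>y\<close> have the same neighbors, hence so do their images.
  Two images in \<open>V\<close> would contradict point-determination, and if just one lies in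
  \<open>V\<close>, it is adjacent to \<open>x\<close> while the other is not.\<close>

lemma Aut_join_twins:
  assumes \<pi>: "\<pi> \<in> Aut G'"
  shows "\<pi> x \<in> {x, y} \<and> \<pi> y \<in> {x, y}"
proof -
  have inj: "inj \<pi>" and bij: "bij \<pi>"
    using \<pi> by (auto simp: Aut_def permutes_inj permutes_bij)
  have "\<pi> x \<noteq> \<pi> y" using inj xy by (auto dest: injD)
  have inV: "\<pi> x \<in> verts G'" "\<pi> y \<in> verts G'"
    using Aut_in_verts[OF \<pi>] by (auto simp: verts_join)
  have twins: "adjacent G' (\<pi> x) w \<longleftrightarrow> adjacent G' (\<pi> y) w" if "w \<in> verts G'" for w
  proof -
    obtain v where v: "w = \<pi> v" using bij by (metis bij_pointE)
    then have "v \<in> verts G'" using that Aut_in_verts[OF \<pi>] by simp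
    then have "adjacent G' (\<pi> x) w \<longleftrightarrow> adjacent G' x v" "adjacent G' (\<pi> y) w \<longleftrightarrow> adjacent G' y v"
      using Aut_adjacent[OF \<pi>] v by (simp_all add: verts_join)
    then show ?thesis
      using x y adjacent_in_V by (auto simp: adjacent_join)
  qed
  show ?thesis
  proof (cases "\<pi> x \<in> V \<and> \<pi> y \<in> V")
    case True
    have "\<pi> x \<notin> {x, y}" "\<pi> y \<notin> {x, y}" using True x y by auto
    then have "adjacent G (\<pi> x) w \<longleftrightarrow> adjacent G (\<pi> y) w" if "w \<in> V" for w
      using twins[of w] that x y unfolding adjacent_join verts_join by blast
    then have "neighborhood G (\<pi> x) = neighborhood G (\<pi> y)"
      unfolding neighborhood_def by blast
    then show ?thesis using pd True \<open>\<pi> x \<noteq> \<pi> y\<close> by (auto simp: point_determining_def)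
  next
    case False
    then show ?thesis
      using inV twins[of x] x y adjacent_in_V[of _ x] by (auto simp: adjacent_join verts_join)
  qed
qed

lemma Aut_join_fixing:
  assumes \<pi>: "\<pi> \<in> Aut G'" and fx: "\<pi> x = x" and fy: "\<pi> y = y"
  shows "\<pi> \<in> Aut G"
proof -
  have p: "\<pi> permutes verts G'" using \<pi> by (simp add: Aut_def)
  have "\<pi> permutes V"
    by (rule permutes_superset[OF p]) (use fx fy in \<open>auto simp: verts_join\<close>)
  moreover have "adjacent G (\<pi> u) (\<pi> v) \<longleftrightarrow> adjacent G u v" if "u \<in> V" "v \<in> V" for u v
  proof -
    have "\<pi> u \<in> V" "\<pi> v \<in> V" using that \<open>\<pi> permutes V\<close> by (simp_all add: permutes_in_image)
    then show ?thesis
      using Aut_adjacent[OF \<pi>, of u v] that x y by (auto simp: adjacent_join verts_join)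
  qed
  ultimately show ?thesis by (simp add: Aut_def graph_isomorphism_def permutes_imp_bij)
qed

text \<open>An automorphism either fixes both \<open>x\<close> and \<open>y\<close> or swaps them;
  in the second case composing with \<open>\<tau>\<close> leads back to the first.\<close>

lemma Aut_join: "Aut G' = Aut G \<union> (\<lambda>\<rho>. \<tau> \<circ> \<rho>) ` Aut G"
proof (intro subset_antisym subsetI)
  fix \<pi> assume \<pi>: "\<pi> \<in> Aut G'"
  have inj: "inj \<pi>" using \<pi> by (auto simp: Aut_def permutes_inj)
  then have ne: "\<pi> x \<noteq> \<pi> y" using xy by (auto dest: injD)
  show "\<pi> \<in> Aut G \<union> (\<lambda>\<rho>. \<tau> \<circ> \<rho>) ` Aut G"
  proof (cases "\<pi> x = x")
    case True
    then have "\<pi> y = y" using Aut_join_twins[OF \<pi>] ne by auto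
    then show ?thesis using Aut_join_fixing \<pi> True by blast
  next
    case False
    then have "\<pi> x = y" "\<pi> y = x" using Aut_join_twins[OF \<pi>] ne by auto
    then have "\<tau> \<circ> \<pi> \<in> Aut G"
      by (intro Aut_join_fixing Aut_comp transpose_Aut_join \<pi>) auto
    then have "\<tau> \<circ> (\<tau> \<circ> \<pi>) \<in> (\<lambda>\<rho>. \<tau> \<circ> \<rho>) ` Aut G" by blast
    then show ?thesis by (simp flip: comp_assoc)
  qed
qed (use Aut_subset_join Aut_comp[OF transpose_Aut_join] in auto)

text \<open>An invariant coloring is constant on every cycle of \<open>\<rho>\<close>, but for
  \<open>\<rho> \<noteq> id\<close> some cycle contains an edge.\<close>

lemma rigid_coloring:
  assumes \<rho>: "\<rho> \<in> Aut G" and proper: "\<And>u v. adjacent G u v \<Longrightarrow> f u \<noteq> f v"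
    and inv: "\<And>v. v \<in> V \<Longrightarrow> f (\<rho> v) = f v"
  shows "\<rho> = id"
proof (rule ccontr)
  assume "\<rho> \<noteq> id"
  then obtain w u v where w: "w \<in> V" and uv: "u \<in> orbit \<rho> w" "v \<in> orbit \<rho> w" "adjacent G u v"
    using rigid \<rho> by (auto simp: cycles_of_def)
  have "u \<in> V \<and> f u = f w" if "u \<in> orbit \<rho> w" for u
    using that by induction (use w inv Aut_in_verts[OF \<rho>] in auto)
  then show False using uv proper by metis
qed

subsection \<open>Weighted classes\<close>

lemma coloring_proper_on_V:
  "f \<in> list_colorings G' L \<Longrightarrow> adjacent G u v \<Longrightarrow> f u \<noteq> f v"
  using adjacent_in_V[of u v] by (auto simp: list_colorings_def verts_join adjacent_join)

text \<open>On \<open>V\<close> the map \<open>\<sigma>\<close> agrees with its part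
  \<open>\<rho>\<close> in \<open>Aut G\<close>, so rigidity applies to \<open>\<rho>\<close>, and
  only the possible factor \<open>\<tau>\<close> remains.\<close>

lemma coloring_stabilizer:
  assumes f: "f \<in> list_colorings G' L" and \<sigma>: "\<sigma> \<in> Aut G'" and inv: "f \<circ> \<sigma> = f"
  shows "\<sigma> = id \<or> \<sigma> = \<tau>"
proof -
  obtain \<rho> where \<rho>: "\<rho> \<in> Aut G" "\<sigma> = \<rho> \<or> \<sigma> = \<tau> \<circ> \<rho>"
    using \<sigma> by (auto simp: Aut_join)
  have "f (\<rho> v) = f v" if "v \<in> V" for v
  proof -
    have "\<sigma> v = \<rho> v" using \<rho> that Aut_in_verts[OF \<rho>(1)] by (auto simp: transpose_fixes)
    then show ?thesis using fun_cong[OF inv, of v] by simp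
  qed
  then have "\<rho> = id"
    using coloring_proper_on_V[OF f] by (intro rigid_coloring[OF \<rho>(1), of f])
  then show ?thesis using \<rho>(2) by simp
qed

lemma coloring_comp_eqD:
  assumes f: "f \<in> list_colorings G' L" and \<pi>: "\<pi> \<in> Aut G'" "\<pi>' \<in> Aut G'"
    and eq: "f \<circ> \<pi> = f \<circ> \<pi>'"
  shows "\<pi> = \<pi>' \<or> \<pi> = \<tau> \<circ> \<pi>'"
proof -
  have p': "\<pi>' permutes verts G'" using \<pi>(2) by (simp add: Aut_def)
  have "f \<circ> (\<pi> \<circ> inv \<pi>') = f \<circ> \<pi>' \<circ> inv \<pi>'" by (simp add: eq flip: comp_assoc)
  also have "\<dots> = f" by (simp add: comp_assoc permutes_inv_o(1)[OF p'])
  finally have "\<pi> \<circ> inv \<pi>' = id \<or> \<pi> \<circ> inv \<pi>' = \<tau>"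
    by (rule coloring_stabilizer[OF f Aut_comp[OF \<pi>(1) Aut_inv[OF \<pi>(2)]]])
  moreover have "\<pi> = (\<pi> \<circ> inv \<pi>') \<circ> \<pi>'" by (simp add: comp_assoc permutes_inv_o(2)[OF p'])
  ultimately show ?thesis by (metis id_comp)
qed

lemma Aut_fixes_xy: "\<rho> \<in> Aut G \<Longrightarrow> \<rho> x = x" "\<rho> \<in> Aut G \<Longrightarrow> \<rho> y = y"
  using Aut_fixes x y by auto

lemma transpose_comp_Aut: "\<rho> \<in> Aut G \<Longrightarrow> (\<tau> \<circ> \<rho>) x = y \<and> (\<tau> \<circ> \<rho>) y = x"
  by (simp add: Aut_fixes_xy)

lemma card_Aut_join: "card (Aut G') = 2 * card (Aut G)"
proof -
  have fin: "finite (Aut G)" by (rule finite_Aut[OF finV])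
  have "inj_on (\<lambda>\<rho>. \<tau> \<circ> \<rho>) (Aut G)"
    by (rule inj_on_inverseI[of _ "\<lambda>\<rho>. \<tau> \<circ> \<rho>"]) (simp flip: comp_assoc)
  then have "card ((\<lambda>\<rho>. \<tau> \<circ> \<rho>) ` Aut G) = card (Aut G)" by (rule card_image)
  moreover have "Aut G \<inter> (\<lambda>\<rho>. \<tau> \<circ> \<rho>) ` Aut G = {}"
  proof -
    have "\<tau> \<circ> \<rho> \<notin> Aut G" if "\<rho> \<in> Aut G" for \<rho>
      using transpose_comp_Aut[OF that] Aut_fixes_xy(1)[of "\<tau> \<circ> \<rho>"] xy by auto
    then show ?thesis by blast
  qed
  ultimately show ?thesis
    unfolding Aut_join using fin by (simp add: card_Un_disjoint)
qed

text \<open>Weight 1 is the case in which swapping the colors \<open>a\<close> of \<open>x\<close> and \<open>b\<close> of \<open>y\<close> yields a different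
  coloring that still respects the lists.\<close>

definition weight :: "('a \<Rightarrow> nat set) \<Rightarrow> nat \<Rightarrow> nat \<Rightarrow> nat" where
  "weight L a b = (if a \<noteq> b \<and> a \<in> L y \<and> b \<in> L x then 1 else 2)"

lemma finite_colorings_join:
  assumes "\<And>v. v \<in> verts G' \<Longrightarrow> finite (L v)"
  shows "finite (list_colorings G' L)"
  using simple_join assms by (intro finite_list_colorings) (auto simp: simple_graph_def)

lemma coloring_in_list: "f \<in> list_colorings G' L \<Longrightarrow> v \<in> verts G' \<Longrightarrow> f v \<in> L v"
  by (auto simp: list_colorings_def)

text \<open>An equivalence keeps or swaps the colors of \<open>x\<close> and \<open>y\<close>. If it
  swaps two different colors, both lie in both lists, because \<open>f\<close> and \<open>g\<close>
  respect the lists; so the weight is 1 on both sides.\<close>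

lemma weight_equiv:
  assumes "(f, g) \<in> coloring_equiv G' L"
  shows "weight L (g x) (g y) = weight L (f x) (f y)"
proof -
  obtain \<pi> where \<pi>: "\<pi> \<in> Aut G'" "g = f \<circ> \<pi>" and fg: "f \<in> list_colorings G' L" "g \<in> list_colorings G' L"
    using assms by (auto simp: coloring_equiv_def)
  have "f x \<in> L x" "f y \<in> L y" "g x \<in> L x" "g y \<in> L y"
    using fg coloring_in_list by (auto simp: verts_join)
  moreover have "g x = f x \<and> g y = f y \<or> g x = f y \<and> g y = f x"
    using \<pi> by (auto simp: Aut_join Aut_fixes_xy)
  ultimately show ?thesis by (auto simp: weight_def)
qed

text \<open>For weight 1 the bound is the order of \<open>Aut G'\<close>. For weight 2 the
  automorphisms in \<open>Aut G\<close> already produce the whole class: reaching a list coloring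
  through \<open>\<tau>\<close> would put both colors in both lists, which forces
  \<open>f x = f y\<close>, and then \<open>\<tau>\<close> has no effect on
  \<open>f\<close>.\<close>

lemma class_weight_le:
  assumes f: "f \<in> list_colorings G' L"
  shows "weight L (f x) (f y) * card (coloring_equiv G' L `` {f}) \<le> 2 * card (Aut G)"
proof -
  let ?C = "coloring_equiv G' L `` {f}"
  have sub: "?C \<subseteq> (\<lambda>\<pi>. f \<circ> \<pi>) ` Aut G'" by (auto simp: coloring_equiv_def)
  have finG: "finite (Aut G)" and finG': "finite (Aut G')"
    using finite_Aut[OF finV] simple_join by (auto intro: finite_Aut simp: simple_graph_def)
  show ?thesis
  proof (cases "f x \<noteq> f y \<and> f x \<in> L y \<and> f y \<in> L x")
    case True
    have "card ?C \<le> card (Aut G')"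
      using card_mono[OF _ sub] card_image_le[OF finG', of "\<lambda>\<pi>. f \<circ> \<pi>"] finG' by force
    then show ?thesis using True by (simp add: weight_def card_Aut_join)
  next
    case False
    have "?C \<subseteq> (\<lambda>\<pi>. f \<circ> \<pi>) ` Aut G"
    proof
      fix g assume g: "g \<in> ?C"
      then obtain \<pi> where \<pi>: "\<pi> \<in> Aut G'" "g = f \<circ> \<pi>" using sub by blast
      have gL: "g \<in> list_colorings G' L" using g by (auto simp: coloring_equiv_def)
      show "g \<in> (\<lambda>\<pi>. f \<circ> \<pi>) ` Aut G"
      proof (cases "\<pi> \<in> Aut G")
        case True then show ?thesis using \<pi> by blast
      next
        case notin: False
        then obtain \<rho> where \<rho>: "\<rho> \<in> Aut G" "\<pi> = \<tau> \<circ> \<rho>" using \<pi> by (auto simp: Aut_join)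
        have "g x = f y" "g y = f x" using transpose_comp_Aut[OF \<rho>(1)] \<pi> \<rho> by auto
        then have "f y \<in> L x" "f x \<in> L y"
          using coloring_in_list[OF gL, of x] coloring_in_list[OF gL, of y] by (auto simp: verts_join)
        then have "f x = f y" using False by blast
        then have "f \<circ> \<tau> = f" by (auto simp: transpose_def)
        then have "g = f \<circ> \<rho>" using \<pi> \<rho> by (simp flip: comp_assoc)
        then show ?thesis using \<rho> by blast
      qed
    qed
    then have "card ?C \<le> card (Aut G)"
      using card_mono[of "(\<lambda>\<pi>. f \<circ> \<pi>) ` Aut G" ?C] card_image_le[OF finG, of "\<lambda>\<pi>. f \<circ> \<pi>"] finG
      by force
    then show ?thesis using False by (auto simp: weight_def)
  qed
qed

text \<open>The class is now the full orbit of \<open>f\<close>. Its stabilizer is trivial if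
  \<open>f x \<noteq> f y\<close> and is generated by \<open>\<tau>\<close> otherwise, so the weight
  makes up for the size of the orbit.\<close>

lemma class_weight_constant:
  assumes f: "f \<in> list_colorings G' (\<lambda>_. B)"
  shows "weight (\<lambda>_. B) (f x) (f y) * card (coloring_equiv G' (\<lambda>_. B) `` {f}) = 2 * card (Aut G)"
proof -
  let ?C = "coloring_equiv G' (\<lambda>_. B) `` {f}"
  have C: "?C = (\<lambda>\<pi>. f \<circ> \<pi>) ` Aut G'"
    using f coloring_comp_Aut[OF f] by (auto simp: coloring_equiv_def)
  have fB: "f x \<in> B" "f y \<in> B" using coloring_in_list[OF f] by (auto simp: verts_join)
  show ?thesis
  proof (cases "f x = f y")
    case False
    have "inj_on (\<lambda>\<pi>. f \<circ> \<pi>) (Aut G')"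
    proof (rule inj_onI)
      fix \<pi> \<pi>' assume \<pi>: "\<pi> \<in> Aut G'" "\<pi>' \<in> Aut G'" "f \<circ> \<pi> = f \<circ> \<pi>'"
      show "\<pi> = \<pi>'"
      proof (rule ccontr)
        assume "\<pi> \<noteq> \<pi>'"
        then have \<tau>: "\<pi> = \<tau> \<circ> \<pi>'" using coloring_comp_eqD[OF f \<pi>] by blast
        have "f (\<pi> x) = f (\<pi>' x)" using \<pi>(3) by (metis comp_apply)
        then show False using \<tau> Aut_join_twins[OF \<pi>(2)] False by auto
      qed
    qed
    then show ?thesis using False fB by (simp add: C card_image card_Aut_join weight_def)
  next
    case True
    then have f\<tau>: "f \<circ> \<tau> = f" by (auto simp: transpose_def)
    have "?C = (\<lambda>\<pi>. f \<circ> \<pi>) ` Aut G"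
      unfolding C Aut_join by (auto simp: image_Un image_image f\<tau> simp flip: comp_assoc)
    moreover have "inj_on (\<lambda>\<pi>. f \<circ> \<pi>) (Aut G)"
    proof (rule inj_onI)
      fix \<pi> \<pi>' assume \<pi>: "\<pi> \<in> Aut G" "\<pi>' \<in> Aut G" "f \<circ> \<pi> = f \<circ> \<pi>'"
      then have "\<pi> = \<pi>' \<or> \<pi> = \<tau> \<circ> \<pi>'" using coloring_comp_eqD[OF f] Aut_subset_join by blast
      moreover have "\<pi> \<noteq> \<tau> \<circ> \<pi>'"
        using transpose_comp_Aut[OF \<pi>(2)] Aut_fixes[OF \<pi>(1) x] xy by auto
      ultimately show "\<pi> = \<pi>'" by blast
    qed
    ultimately show ?thesis using True by (simp add: card_image weight_def)
  qed
qed

lemma sum_weight_classes: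
  assumes fin: "\<And>v. v \<in> verts G' \<Longrightarrow> finite (L v)"
  shows "(\<Sum>f\<in>list_colorings G' L. weight L (f x) (f y)) =
    (\<Sum>C\<in>list_colorings G' L // coloring_equiv G' L. \<Sum>f\<in>C. weight L (f x) (f y))"
proof -
  note eq = equiv_coloring_equiv[of G' L]
  have "(\<Sum>f\<in>\<Union>(list_colorings G' L // coloring_equiv G' L). weight L (f x) (f y)) =
    (\<Sum>C\<in>list_colorings G' L // coloring_equiv G' L. \<Sum>f\<in>C. weight L (f x) (f y))"
    using quotient_disj[OF eq] finite_equiv_class[OF finite_colorings_join[OF fin]] equiv_type[OF eq]
    by (subst sum.Union_disjoint) (auto simp: comp_def)
  then show ?thesis by (simp add: Union_quotient[OF eq])
qed

lemma sum_weight_class: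
  assumes "C \<in> list_colorings G' L // coloring_equiv G' L"
  obtains f where "f \<in> list_colorings G' L"
    "(\<Sum>g\<in>C. weight L (g x) (g y)) = weight L (f x) (f y) * card (coloring_equiv G' L `` {f})"
proof -
  obtain f where f: "f \<in> list_colorings G' L" "C = coloring_equiv G' L `` {f}"
    using assms by (rule quotientE)
  have "(\<Sum>g\<in>C. weight L (g x) (g y)) = (\<Sum>g\<in>C. weight L (f x) (f y))"
    using weight_equiv by (intro sum.cong refl) (auto simp: f)
  then show thesis using that[OF f(1)] by (simp add: f(2))
qed

text \<open>This replaces the number of classes by a weighted count of single colorings, which can
  be compared without reference to automorphisms.\<close>

lemma sum_weight_le:
  assumes fin: "\<And>v. v \<in> verts G' \<Longrightarrow> finite (L v)"
  shows "(\<Sum>f\<in>list_colorings G' L. weight L (f x) (f y)) \<le> 2 * card (Aut G) * u_list G' L"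
proof -
  have "(\<Sum>g\<in>C. weight L (g x) (g y)) \<le> 2 * card (Aut G)"
    if C: "C \<in> list_colorings G' L // coloring_equiv G' L" for C
    by (rule sum_weight_class[OF C]) (simp add: class_weight_le)
  then have "(\<Sum>C\<in>list_colorings G' L // coloring_equiv G' L. \<Sum>f\<in>C. weight L (f x) (f y))
    \<le> (\<Sum>C\<in>list_colorings G' L // coloring_equiv G' L. 2 * card (Aut G))"
    by (rule sum_mono)
  then show ?thesis by (simp add: sum_weight_classes[OF fin] u_list_def mult.commute)
qed

lemma sum_weight_constant:
  assumes "finite B"
  shows "(\<Sum>f\<in>list_colorings G' (\<lambda>_. B). weight (\<lambda>_. B) (f x) (f y))
    = 2 * card (Aut G) * u_list G' (\<lambda>_. B)"
proof -
  have "(\<Sum>g\<in>C. weight (\<lambda>_. B) (g x) (g y)) = 2 * card (Aut G)"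
    if C: "C \<in> list_colorings G' (\<lambda>_. B) // coloring_equiv G' (\<lambda>_. B)" for C
    by (rule sum_weight_class[OF C]) (simp add: class_weight_constant)
  then show ?thesis using assms by (simp add: sum_weight_classes u_list_def mult.commute)
qed

section \<open>Summation over the colors of \<open>x\<close> and \<open>y\<close>\<close>

text \<open>Once \<open>x\<close> and \<open>y\<close> have colors \<open>a\<close> and
  \<open>b\<close>, what remains is a coloring of \<open>G\<close> that avoids both. As
  \<open>x\<close> and \<open>y\<close> are not adjacent, \<open>a = b\<close> is allowed.\<close>

lemma sum_weight_pairs:
  assumes fin: "\<And>v. v \<in> verts G' \<Longrightarrow> finite (L v)"
  shows "(\<Sum>f\<in>list_colorings G' L. weight L (f x) (f y)) =
    (\<Sum>a\<in>L x. \<Sum>b\<in>L y. weight L a b * card (list_colorings G (\<lambda>v. L v - {a, b})))"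
proof -
  let ?Q = "\<lambda>(a, b). list_colorings G (\<lambda>v. L v - {a, b})"
  let ?S = "Sigma (L x \<times> L y) ?Q"
  have finxy: "finite (L x)" "finite (L y)" using fin by (auto simp: verts_join)
  have finQ: "finite (?Q p)" for p
    using fin finV by (auto simp: verts_join intro!: finite_list_colorings split: prod.split)
  have "(\<Sum>f\<in>list_colorings G' L. weight L (f x) (f y)) = (\<Sum>p\<in>?S. weight L (fst (fst p)) (snd (fst p)))"
  proof (rule sum.reindex_bij_witness
      [where i = "\<lambda>p. (snd p)(x := fst (fst p), y := snd (fst p))"
         and j = "\<lambda>f. ((f x, f y), restrict f V)"])
    fix f assume f: "f \<in> list_colorings G' L"
    show "(snd ((f x, f y), restrict f V))(x := fst (fst ((f x, f y), restrict f V)),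
        y := snd (fst ((f x, f y), restrict f V))) = f"
      using f by (auto simp: list_colorings_def PiE_iff extensional_def verts_join fun_eq_iff)
    show "((f x, f y), restrict f V) \<in> ?S"
      using f by (auto simp: list_colorings_def verts_join adjacent_join)
    show "weight L (fst (fst ((f x, f y), restrict f V))) (snd (fst ((f x, f y), restrict f V)))
        = weight L (f x) (f y)" by simp
  next
    fix p assume "p \<in> ?S"
    then obtain a b g where p: "p = ((a, b), g)" "a \<in> L x" "b \<in> L y"
      and g: "g \<in> list_colorings G (\<lambda>v. L v - {a, b})" by auto
    let ?f = "g(x := a, y := b)"
    have gV: "g v \<in> L v" "g v \<noteq> a" "g v \<noteq> b" if "v \<in> V" for v
      using g that by (auto simp: list_colorings_def)
    have ext: "g v = undefined" if "v \<notin> V" for v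
      using g that by (auto simp: list_colorings_def PiE_iff extensional_def)
    have proper: "g u \<noteq> g v" if "adjacent G u v" for u v
      using g that adjacent_in_V[OF that] by (auto simp: list_colorings_def)
    have fV: "?f v = g v" if "v \<in> V" for v using that x y by auto
    have "?f \<in> Pi\<^sub>E (verts G') L"
      using gV ext p xy by (auto simp: verts_join PiE_iff extensional_def)
    moreover have "?f u \<noteq> ?f v" if uv: "adjacent G' u v" for u v
    proof -
      consider "adjacent G u v" | "u \<in> {x, y}" "v \<in> V" | "v \<in> {x, y}" "u \<in> V"
        using uv by (auto simp: adjacent_join)
      then show ?thesis
      proof cases
        case 1 then show ?thesis using proper fV adjacent_in_V by metis
      next
        case 2 then show ?thesis using gV[of v] fV[of v] xy by auto
      next
        case 3 then show ?thesis using gV[of u] fV[of u] xy by auto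
      qed
    qed
    ultimately show "(snd p)(x := fst (fst p), y := snd (fst p)) \<in> list_colorings G' L"
      by (simp add: list_colorings_def p)
    have "restrict ?f V = g" using fV ext by (auto simp: restrict_def fun_eq_iff)
    show "((((snd p)(x := fst (fst p), y := snd (fst p))) x, ((snd p)(x := fst (fst p), y := snd (fst p))) y),
       restrict ((snd p)(x := fst (fst p), y := snd (fst p))) V) = p"
      using xy \<open>restrict ?f V = g\<close> by (simp add: p)
  qed
  also have "\<dots> = (\<Sum>p\<in>L x \<times> L y. \<Sum>g\<in>?Q p. weight L (fst p) (snd p))"
    using finxy finQ by (subst sum.Sigma) (auto simp: split_beta)
  also have "\<dots> = (\<Sum>a\<in>L x. \<Sum>b\<in>L y. weight L a b * card (list_colorings G (\<lambda>v. L v - {a, b})))"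
    by (simp add: sum.cartesian_product split_beta mult.commute)
  finally show ?thesis .
qed

text \<open>Start with \<open>2 * p2\<close> for each of the \<open>k ^ 2\<close> pairs. With
  \<open>s\<close> common colors, \<open>s\<close> pairs are diagonal and need a correction of
  \<open>2 * p1 - 2 * p2\<close>, and \<open>s ^ 2 - s\<close> pairs have weight 1 and need
  \<open>- p2\<close>. Only \<open>s\<close> enters the result; integers are used because of the
  subtraction.\<close>

lemma sum_weight_two_values:
  fixes p1 p2 :: int
  assumes fin: "finite (L x)" "finite (L y)" and k: "card (L x) = k" "card (L y) = k"
  shows "(\<Sum>a\<in>L x. \<Sum>b\<in>L y. int (weight L a b) * (if a = b then p1 else p2)) =
    2 * int k ^ 2 * p2 + int (card (L x \<inter> L y)) * (2 * p1 - p2) - int (card (L x \<inter> L y)) ^ 2 * p2"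
proof -
  have "(\<Sum>a\<in>L x. \<Sum>b\<in>L y. int (weight L a b) * (if a = b then p1 else p2)) =
    (\<Sum>a\<in>L x. \<Sum>b\<in>L y. 2 * p2 + (if a = b then 2 * p1 - p2 else 0)
       - of_bool (a \<in> L y) * (of_bool (b \<in> L x) * p2))"
    by (intro sum.cong refl) (auto simp: weight_def)
  also have "\<dots> = (\<Sum>a\<in>L x. int k * (2 * p2) + (if a \<in> L y then 2 * p1 - p2 else 0)
      - of_bool (a \<in> L y) * (int (card (L x \<inter> L y)) * p2))"
  proof (intro sum.cong refl)
    fix a
    have "(\<Sum>b\<in>L y. of_bool (b \<in> L x) * p2) = int (card (L x \<inter> L y)) * p2"
      using fin by (simp add: Int_commute Int_def flip: sum_distrib_right)
    then show "(\<Sum>b\<in>L y. 2 * p2 + (if a = b then 2 * p1 - p2 else 0)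
       - of_bool (a \<in> L y) * (of_bool (b \<in> L x) * p2)) =
      int k * (2 * p2) + (if a \<in> L y then 2 * p1 - p2 else 0)
      - of_bool (a \<in> L y) * (int (card (L x \<inter> L y)) * p2)"
      using fin k by (simp add: sum.distrib sum_subtractf flip: sum_distrib_left)
  qed
  also have "\<dots> = int k * (int k * (2 * p2)) + int (card (L x \<inter> L y)) * (2 * p1 - p2)
      - int (card (L x \<inter> L y)) * (int (card (L x \<inter> L y)) * p2)"
    using fin k by (simp add: sum.distrib sum_subtractf sum.If_cases Int_def flip: sum_distrib_right)
  finally show ?thesis by (simp add: power2_eq_square algebra_simps)
qed

text \<open>Both sides are multiplied by \<open>2 * card (Aut G)\<close> and compared as total
  weights. The bound on \<open>k\<close> adds up the separate demands on \<open>k - 2\<close> made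
  by the minimality of constant lists and by the growth estimate.\<close>

theorem u_list_constant_minimal:
  assumes k: "2 * card V + 2 * 2 ^ card V + 2 * 2 ^ card (edges G) + 3 \<le> k"
    and L: "k_assignment G' k L"
  shows "u_list G' (\<lambda>_. {1..k}) \<le> u_list G' L"
proof -
  define P where "P j = int (card (list_colorings G (\<lambda>_. {1..j})))" for j :: nat
  let ?B = "\<lambda>_ :: 'a. {1..k}"
  \<comment> \<open>Equal colors on \<open>x\<close> and \<open>y\<close> cost the vertices of
    \<open>G\<close> one color, different colors at most two.\<close>
  let ?p = "\<lambda>a b :: nat. if a = b then P (k - 1) else P (k - 2)"
  have finL: "finite (L v)" "card (L v) = k" if "v \<in> verts G'" for v
    using L that by (auto simp: k_assignment_def)
  have Lxy: "finite (L x)" "finite (L y)" "card (L x) = k" "card (L y) = k"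
    using finL by (auto simp: verts_join)
  define s where "s = card (L x \<inter> L y)"
  have s: "s \<le> k" unfolding s_def using Lxy by (metis card_mono inf_le1)
  have large: "2 * 2 ^ card (edges G) \<le> k - 1" "2 * 2 ^ card (edges G) \<le> k - 2" using k by auto
  have ge: "?p a b \<le> int (card (list_colorings G (\<lambda>v. L v - {a, b})))" for a b
  proof -
    have *: "k - card {a, b} \<le> card (L v - {a, b})" if "v \<in> V" for v
      using finL[of v] that diff_card_le_card_Diff[of "{a, b}" "L v"] by (auto simp: verts_join)
    have "card (list_colorings G (\<lambda>_. {1..k - card {a, b}})) \<le> card (list_colorings G (\<lambda>v. L v - {a, b}))"
      using * finL large by (intro card_list_colorings_ge_constant'[OF simple, of "k - card {a, b}"])
        (auto simp: verts_join card_insert_if numeral_2_eq_2)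
    then show ?thesis by (auto simp: P_def card_insert_if numeral_2_eq_2)
  qed
  \<comment> \<open>\<open>{1..k} - {a, b}\<close> is not an initial segment. Minimality applied in
    both directions shows that only the size of the constant list matters.\<close>
  have eq: "int (card (list_colorings G (\<lambda>v. {1..k} - {a, b}))) = ?p a b"
    if ab: "a \<in> {1..k}" "b \<in> {1..k}" for a b
  proof -
    let ?c = "k - card {a, b}"
    have card: "card ({1..k} - {a, b}) = ?c" using ab by (subst card_Diff_subset) auto
    have c: "2 * 2 ^ card (edges G) \<le> ?c" using large by (auto simp: card_insert_if numeral_2_eq_2)
    have "card (list_colorings G (\<lambda>v. {1..k} - {a, b})) = card (list_colorings G (\<lambda>_. {1..?c}))"
      using card_list_colorings_ge_constant[OF simple c, of "\<lambda>_. {1..?c}" "{1..k} - {a, b}"]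
        card_list_colorings_ge_constant[OF simple c, of "\<lambda>_. {1..k} - {a, b}" "{1..?c}"] card
      by simp
    then show ?thesis by (simp add: P_def card_insert_if numeral_2_eq_2)
  qed
  have ratio: "2 * P (k - 1) \<le> (int k + 1) * P (k - 2)"
  proof -
    have "card {1..k - 1} = Suc (k - 2)" "2 * card V < k - 2" "2 * 2 ^ card V \<le> k - 2"
      and k3: "k - 2 + 3 = k + 1"
      using k by auto
    then have "2 * card (list_colorings G (\<lambda>_. {1..k - 1})) \<le> (k - 2 + 3) * card (list_colorings G (\<lambda>_. {1..k - 2}))"
      by (intro card_colorings_Suc_le[OF simple]) simp_all
    then have "2 * card (list_colorings G (\<lambda>_. {1..k - 1})) \<le> (k + 1) * card (list_colorings G (\<lambda>_. {1..k - 2}))"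
      unfolding k3 .
    from of_nat_mono[OF this, where 'a = int] show ?thesis by (simp add: P_def distrib_right)
  qed
  have "int (2 * card (Aut G) * u_list G' ?B) = (\<Sum>a\<in>{1..k}. \<Sum>b\<in>{1..k}. int (weight ?B a b) * ?p a b)"
  proof -
    have "2 * card (Aut G) * u_list G' ?B =
      (\<Sum>a\<in>{1..k}. \<Sum>b\<in>{1..k}. weight ?B a b * card (list_colorings G (\<lambda>v. {1..k} - {a, b})))"
      using sum_weight_constant[of "{1..k}"] sum_weight_pairs[of ?B] by simp
    then have "int (2 * card (Aut G) * u_list G' ?B) =
      (\<Sum>a\<in>{1..k}. \<Sum>b\<in>{1..k}. int (weight ?B a b) * int (card (list_colorings G (\<lambda>v. {1..k} - {a, b}))))"
      by (simp only: of_nat_sum of_nat_mult)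
    also have "\<dots> = (\<Sum>a\<in>{1..k}. \<Sum>b\<in>{1..k}. int (weight ?B a b) * ?p a b)"
      by (intro sum.cong refl arg_cong2[of _ _ _ _ "(*)"] eq)
    finally show ?thesis .
  qed
  \<comment> \<open>This is the closed form for \<open>k\<close> common colors; the next line
    compares it with the one for \<open>s\<close>.\<close>
  also have "\<dots> = 2 * int k ^ 2 * P (k - 2) + int k * (2 * P (k - 1) - P (k - 2)) - int k ^ 2 * P (k - 2)"
    using sum_weight_two_values[of ?B k] by simp
  also have "\<dots> \<le> 2 * int k ^ 2 * P (k - 2) + int s * (2 * P (k - 1) - P (k - 2)) - int s ^ 2 * P (k - 2)"
  proof -
    \<comment> \<open>The product is the difference of the two closed forms. \<open>ratio\<close>
      settles its second factor for \<open>s = 0\<close>, and a larger \<open>s\<close> only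
      increases that factor.\<close>
    have "0 \<le> (int k - int s) * ((int k + int s + 1) * P (k - 2) - 2 * P (k - 1))"
    proof (rule mult_nonneg_nonneg)
      have "(int k + 1) * P (k - 2) \<le> (int k + int s + 1) * P (k - 2)"
        by (rule mult_right_mono) (simp_all add: P_def)
      then show "0 \<le> (int k + int s + 1) * P (k - 2) - 2 * P (k - 1)" using ratio by linarith
    qed (use s in simp)
    then show ?thesis by (simp add: algebra_simps power2_eq_square)
  qed
  also have "\<dots> = (\<Sum>a\<in>L x. \<Sum>b\<in>L y. int (weight L a b) * ?p a b)"
    unfolding s_def by (rule sum_weight_two_values[OF Lxy, symmetric])
  also have "\<dots> \<le> (\<Sum>a\<in>L x. \<Sum>b\<in>L y. int (weight L a b) * int (card (list_colorings G (\<lambda>v. L v - {a, b}))))"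
    by (intro sum_mono mult_left_mono ge) simp
  also have "\<dots> = int (\<Sum>f\<in>list_colorings G' L. weight L (f x) (f y))"
    using sum_weight_pairs[of L] finL by simp
  also have "\<dots> \<le> int (2 * card (Aut G) * u_list G' L)"
    using sum_weight_le[of L] finL by (intro of_nat_mono) simp
  finally have "2 * card (Aut G) * u_list G' ?B \<le> 2 * card (Aut G) * u_list G' L"
    by (simp only: of_nat_le_iff)
  moreover have "0 < card (Aut G)"
    using id_in_Aut finite_Aut[OF finV] by (auto simp: card_gt_0_iff)
  ultimately show ?thesis by simp
qed

end

subsection \<open>Hanlon's unlabeled chromatic polynomial\<close>

lemma verts_permute_graph: "\<pi> permutes verts H \<Longrightarrow> verts (permute_graph \<pi> H) = verts H"
  by (simp add: permute_graph_def permutes_image)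

lemma permute_graph_comp: "permute_graph \<sigma> (permute_graph \<pi> H) = permute_graph (\<sigma> \<circ> \<pi>) H"
  by (simp add: permute_graph_def image_comp image_image)

text \<open>Turns the relational notion of isomorphism into equality of graphs. Simplicity ensures
  that each edge is a pair of vertices, so that adjacency determines the edge set.\<close>

lemma permute_graph_isomorphism:
  assumes iso: "graph_isomorphism \<phi> H H'" and H: "simple_graph H" and H': "simple_graph H'"
  shows "permute_graph \<phi> H = H'"
proof -
  have verts: "\<phi> ` verts H = verts H'"
    using iso by (simp add: graph_isomorphism_def bij_betw_def)
  have "(\<lambda>e. \<phi> ` e) ` edges H = edges H'"
  proof (intro subset_antisym subsetI)
    fix e' assume "e' \<in> (\<lambda>e. \<phi> ` e) ` edges H"
    then obtain e where e: "e \<in> edges H" "e' = \<phi> ` e" by blast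
    obtain u v where "e = {u, v}" "u \<in> verts H" "v \<in> verts H"
      using simple_graph_edgeE[OF H e(1)] by blast
    then show "e' \<in> edges H'" using iso e by (simp add: graph_isomorphism_def)
  next
    fix e' assume e': "e' \<in> edges H'"
    obtain a b where ab: "e' = {a, b}" "a \<in> verts H'" "b \<in> verts H'"
      using simple_graph_edgeE[OF H' e'] by blast
    obtain u v where uv: "a = \<phi> u" "b = \<phi> v" "u \<in> verts H" "v \<in> verts H"
      using ab verts by blast
    then have "{u, v} \<in> edges H" using iso e' ab by (simp add: graph_isomorphism_def)
    then show "e' \<in> (\<lambda>e. \<phi> ` e) ` edges H" using ab uv by (intro image_eqI[of _ _ "{u, v}"]) auto
  qed
  then show ?thesis using verts by (simp add: permute_graph_def)
qed

text \<open>Identifies the stabilizer of \<open>H\<close> in the symmetric group on its vertices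
  with \<open>Aut H\<close>.\<close>

lemma permute_graph_eq_iff_Aut:
  assumes H: "simple_graph H" and \<pi>: "\<pi> permutes verts H"
  shows "permute_graph \<pi> H = H \<longleftrightarrow> \<pi> \<in> Aut H"
proof
  assume "\<pi> \<in> Aut H"
  then show "permute_graph \<pi> H = H"
    using permute_graph_isomorphism[OF _ H H] by (simp add: Aut_def)
next
  assume "permute_graph \<pi> H = H"
  then have E: "(\<lambda>e. \<pi> ` e) ` edges H = edges H"
    by (metis permute_graph_def sgraph.select_convs(2))
  have "adjacent H u v \<longleftrightarrow> adjacent H (\<pi> u) (\<pi> v)" for u v
  proof -
    have "adjacent H (\<pi> u) (\<pi> v) \<longleftrightarrow> \<pi> ` {u, v} \<in> (\<lambda>e. \<pi> ` e) ` edges H" using E by simp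
    also have "\<dots> \<longleftrightarrow> {u, v} \<in> edges H"
    proof
      assume "\<pi> ` {u, v} \<in> (\<lambda>e. \<pi> ` e) ` edges H"
      then obtain e where e: "\<pi> ` {u, v} = \<pi> ` e" "e \<in> edges H" by (rule imageE)
      have "{u, v} = e" using e(1) by (simp only: inj_image_eq_iff[OF permutes_inj[OF \<pi>]])
      then show "{u, v} \<in> edges H" using e(2) by simp
    qed (rule imageI)
    finally show ?thesis ..
  qed
  then show "\<pi> \<in> Aut H"
    using \<pi> by (simp add: Aut_def graph_isomorphism_def permutes_imp_bij)
qed

lemma colored_orbit_permute:
  assumes \<sigma>: "\<sigma> permutes verts H"
  shows "colored_orbit (permute_graph \<sigma> H, f \<circ> inv \<sigma>) = colored_orbit (H, f)"
proof -
  have act: "(permute_graph \<pi> (permute_graph \<sigma> H), f \<circ> inv \<sigma> \<circ> inv \<pi>) = (permute_graph (\<pi> \<circ> \<sigma>) H, f \<circ> inv (\<pi> \<circ> \<sigma>))"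
    if "\<pi> permutes verts H" for \<pi>
    using that \<sigma> by (simp add: permute_graph_comp o_inv_distrib permutes_bij comp_assoc)
  show ?thesis
  proof (intro subset_antisym subsetI)
    fix p assume "p \<in> colored_orbit (permute_graph \<sigma> H, f \<circ> inv \<sigma>)"
    then obtain \<pi> where \<pi>: "\<pi> permutes verts H"
      "p = (permute_graph \<pi> (permute_graph \<sigma> H), f \<circ> inv \<sigma> \<circ> inv \<pi>)"
      by (auto simp: colored_orbit_def verts_permute_graph[OF \<sigma>])
    then show "p \<in> colored_orbit (H, f)"
      using act permutes_compose[OF \<sigma> \<pi>(1)] by (auto simp: colored_orbit_def)
  next
    fix p assume "p \<in> colored_orbit (H, f)"
    then obtain \<pi> where \<pi>: "\<pi> permutes verts H" "p = (permute_graph \<pi> H, f \<circ> inv \<pi>)"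
      by (auto simp: colored_orbit_def)
    define \<rho> where "\<rho> = \<pi> \<circ> inv \<sigma>"
    have \<rho>: "\<rho> permutes verts H"
      unfolding \<rho>_def by (rule permutes_compose[OF permutes_inv[OF \<sigma>] \<pi>(1)])
    have "\<pi> = \<rho> \<circ> \<sigma>" by (simp add: \<rho>_def comp_assoc permutes_inv_o(2)[OF \<sigma>])
    then have "p = (permute_graph \<rho> (permute_graph \<sigma> H), f \<circ> inv \<sigma> \<circ> inv \<rho>)"
      using act[OF \<rho>] \<pi>(2) by simp
    then show "p \<in> colored_orbit (permute_graph \<sigma> H, f \<circ> inv \<sigma>)"
      using \<rho> unfolding colored_orbit_def by (auto simp: verts_permute_graph[OF \<sigma>])
  qed
qed

text \<open>A permutation carrying \<open>(H, f)\<close> to \<open>(H, g)\<close> must stabilize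
  \<open>H\<close>, so it is an automorphism. The action uses \<open>inv \<pi>\<close> and the
  equivalence uses \<open>\<pi>\<close>; closure of \<open>Aut H\<close> under inverses reconciles
  them.\<close>

lemma colored_orbit_eq_iff:
  assumes H: "simple_graph H" and f: "f \<in> list_colorings H L" and g: "g \<in> list_colorings H L"
  shows "colored_orbit (H, f) = colored_orbit (H, g) \<longleftrightarrow> (f, g) \<in> coloring_equiv H L"
proof
  assume eq: "colored_orbit (H, f) = colored_orbit (H, g)"
  have "(permute_graph id H, g \<circ> inv id) \<in> colored_orbit (H, g)"
    unfolding colored_orbit_def by (auto intro!: exI[of _ id] permutes_id)
  then have "(H, g) \<in> colored_orbit (H, f)"
    using permute_graph_eq_iff_Aut[OF H permutes_id] id_in_Aut[of H] eq by simp
  then obtain \<pi> where \<pi>: "\<pi> permutes verts H" "H = permute_graph \<pi> H" "g = f \<circ> inv \<pi>"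
    unfolding colored_orbit_def prod.case by blast
  have "inv \<pi> \<in> Aut H"
    using permute_graph_eq_iff_Aut[OF H \<pi>(1)] \<pi>(2)[symmetric] by (intro Aut_inv) blast
  then show "(f, g) \<in> coloring_equiv H L" using f g \<pi>(3) by (auto simp: coloring_equiv_def)
next
  assume "(f, g) \<in> coloring_equiv H L"
  then obtain \<pi> where \<pi>: "\<pi> \<in> Aut H" "g = f \<circ> \<pi>" by (auto simp: coloring_equiv_def)
  have p: "\<pi> permutes verts H" using \<pi>(1) by (simp add: Aut_def)
  have "permute_graph (inv \<pi>) H = H"
    using permute_graph_eq_iff_Aut[OF H permutes_inv[OF p]] Aut_inv[OF \<pi>(1)] by blast
  then show "colored_orbit (H, f) = colored_orbit (H, g)"
    using colored_orbit_permute[OF permutes_inv[OF p], of f] by (simp add: \<pi>(2) permutes_inv_inv[OF p])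
qed

text \<open>\<open>F\<close> and \<open>F'\<close> have the same fibers on \<open>A\<close>, which
  gives a bijection between their images. It serves to match orbits with equivalence
  classes.\<close>

lemma card_image_eq_card_image:
  assumes "\<And>a b. a \<in> A \<Longrightarrow> b \<in> A \<Longrightarrow> F a = F b \<longleftrightarrow> F' a = F' b"
  shows "card (F ` A) = card (F' ` A)"
proof -
  let ?h = "\<lambda>z. F' (inv_into A F z)"
  have h: "?h (F a) = F' a" if "a \<in> A" for a
    using assms[OF inv_into_into[of "F a" F A] that] f_inv_into_f[of "F a" F A] that by simp
  have "inj_on ?h (F ` A)"
    by (rule inj_onI) (use h assms in auto)
  moreover have "?h ` F ` A = F' ` A" using h by (force simp: image_image)
  ultimately show ?thesis by (metis card_image)
qed

text \<open>All members of the unlabeled graph share one vertex set, so an isomorphism from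
  \<open>H\<close> to \<open>H'\<close> acts as a permutation and moves a colored copy of
  \<open>H'\<close> into the orbit of a coloring of \<open>H\<close>.\<close>

lemma colored_orbits_of_representative:
  assumes H: "H \<in> unlabeled G"
  shows "colored_orbit ` colored_graphs (unlabeled G) k =
    (\<lambda>f. colored_orbit (H, f)) ` list_colorings H (\<lambda>_. {1..k})"
proof (intro subset_antisym image_subsetI)
  fix f assume "f \<in> list_colorings H (\<lambda>_. {1..k})"
  then show "colored_orbit (H, f) \<in> colored_orbit ` colored_graphs (unlabeled G) k"
    using H by (auto simp: colored_graphs_def)
next
  fix p assume "p \<in> colored_graphs (unlabeled G) k"
  then obtain H' g where p: "p = (H', g)" and H': "H' \<in> unlabeled G"
    and g: "g \<in> list_colorings H' (\<lambda>_. {1..k})"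
    by (auto simp: colored_graphs_def)
  have verts: "verts H' = verts H" using H H' by (simp add: unlabeled_def)
  obtain \<phi> \<psi> where "graph_isomorphism \<phi> G H" "graph_isomorphism \<psi> G H'"
    using H H' by (auto simp: unlabeled_def isomorphic_def)
  then obtain \<theta> where \<theta>: "graph_isomorphism \<theta> H H'"
    using graph_isomorphism_comp graph_isomorphism_inv by metis
  \<comment> \<open>\<open>\<theta>\<close> is arbitrary outside the vertices, whereas
    \<open>permutes\<close> requires the identity there.\<close>
  define \<pi> where "\<pi> = (\<lambda>v. if v \<in> verts H then \<theta> v else v)"
  have iso: "graph_isomorphism \<pi> H H'"
    using \<theta> by (auto simp: graph_isomorphism_def \<pi>_def cong: bij_betw_cong)
  have perm: "\<pi> permutes verts H"
    using iso verts by (intro bij_imp_permutes) (auto simp: graph_isomorphism_def \<pi>_def)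
  have H'_eq: "permute_graph \<pi> H = H'"
    using permute_graph_isomorphism[OF iso] H H' by (simp add: unlabeled_def)
  have "g \<circ> \<pi> \<in> list_colorings H (\<lambda>_. {1..k})"
    using g iso permutes_in_image[OF perm] verts
    by (auto simp: list_colorings_def PiE_iff extensional_def graph_isomorphism_def)
  moreover have "g = (g \<circ> \<pi>) \<circ> inv \<pi>" by (simp add: comp_assoc permutes_inv_o(1)[OF perm])
  then have "colored_orbit p = colored_orbit (H, g \<circ> \<pi>)"
    using colored_orbit_permute[OF perm, of "g \<circ> \<pi>"] by (simp add: p H'_eq)
  ultimately show "colored_orbit p \<in> (\<lambda>f. colored_orbit (H, f)) ` list_colorings H (\<lambda>_. {1..k})"
    by blast
qed

lemma P_unlabeled_eq_u_list:
  assumes "simple_graph G"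
  shows "P_unlabeled (unlabeled G) k = u_list G (\<lambda>_. {1..k})"
proof -
  obtain H where H: "H \<in> unlabeled G" using unlabeled_nonempty[OF assms] by blast
  then have simple: "simple_graph H" by (simp add: unlabeled_def)
  obtain \<phi> where \<phi>: "graph_isomorphism \<phi> G H" using H by (auto simp: unlabeled_def isomorphic_def)
  have "P_unlabeled (unlabeled G) k = u_list H (\<lambda>_. {1..k})"
    unfolding P_unlabeled_def colored_orbits_of_representative[OF H] u_list_def quotient_eq_image
    by (rule card_image_eq_card_image)
      (simp add: colored_orbit_eq_iff[OF simple] eq_equiv_class_iff[OF equiv_coloring_equiv])
  also have "\<dots> = u_list G (\<lambda>_. {1..k})"
    using u_list_transfer[OF \<phi>, of "\<lambda>_. {1..k}"] by (simp add: comp_def)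
  finally show ?thesis .
qed

section \<open>The minimum over all assignments, and the conclusion\<close>

text \<open>\<open>G\<close> itself may have other vertices than the members of
  \<open>unlabeled G\<close>; invariance under isomorphism passes the minimum from the chosen member
  to \<open>G\<close>.\<close>

lemma P_list_eq_min_u_list:
  assumes "simple_graph G"
  shows "P_list (unlabeled G) k = min_u_list G k"
proof -
  obtain H where H: "H \<in> unlabeled G" using unlabeled_nonempty[OF assms] by blast
  then show ?thesis
    using P_list_eq[OF H] min_u_list_isomorphic[of G H k] by (simp add: unlabeled_def)
qed

theorem theorem1p10:
  fixes G :: "'a sgraph" and x y :: 'a
  assumes "simple_graph G"
    and "point_determining G"
    and "\<forall>\<pi> \<in> Aut G. \<pi> \<noteq> id \<longrightarrow>
           (\<exists>C \<in> cycles_of \<pi> (verts G). \<exists>u \<in> C. \<exists>v \<in> C. adjacent G u v)"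
    and "x \<notin> verts G" and "y \<notin> verts G" and "x \<noteq> y"
  shows "\<exists>N::nat. \<forall>k\<ge>N. P_list (unlabeled (add_two_vertices G x y)) k
                       = P_unlabeled (unlabeled (add_two_vertices G x y)) k"
proof -
  interpret rigid_join G x y by unfold_locales (fact assms)+
  define N where "N = 2 * card V + 2 * 2 ^ card V + 2 * 2 ^ card (edges G) + 3"
  have "P_list (unlabeled G') k = P_unlabeled (unlabeled G') k" if k: "N \<le> k" for k
  proof -
    have "min_u_list G' k = u_list G' (\<lambda>_. {1..k})"
      unfolding min_u_list_def
    proof (rule Least_equality)
      show "\<exists>L. k_assignment G' k L \<and> u_list G' (\<lambda>_. {1..k}) = u_list G' L"
        by (intro exI[of _ "\<lambda>_. {1..k}"]) (simp add: k_assignment_def)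
      fix m assume "\<exists>L. k_assignment G' k L \<and> m = u_list G' L"
      then show "u_list G' (\<lambda>_. {1..k}) \<le> m"
        using u_list_constant_minimal k by (auto simp: N_def)
    qed
    then show ?thesis
      by (simp add: P_list_eq_min_u_list[OF simple_join] P_unlabeled_eq_u_list[OF simple_join])
  qed
  then show ?thesis by blast
qed

end
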